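(* Let $k\ge1$ and let $\mathcal P=\{p_1,\dots,p_{k^2}\}$ be a family of real polynomials in the commuting variables $x_1,\dots,x_{2k^2}$ that admits two nc representations $p(X,Y)$ and $\widetilde p(\widetilde X,\widetilde Y)$ with $p,\widetilde p\in\mathcal Q$. Then there exists a $k\times k$ permutation matrix $\Pi$ such that one of the following holds: (1) $X=\Pi^T\widetilde X\Pi$, $Y=\Pi^T\widetilde Y\Pi$; (2) $X=\Pi^T\widetilde X^T\Pi$, $Y=\Pi^T\widetilde Y^T\Pi$; (3) $X=\Pi^T\widetilde Y\Pi$, $Y=\Pi^T\widetilde X\Pi$; (4) $X=\Pi^T\widetilde Y^T\Pi$, $Y=\Pi^T\widetilde X^T\Pi$.
   Context: The family $\mathcal P$ admits an nc representation $p(X,Y)$ if there are $k\times k$ matrices $X,Y$ whose $2k^2$ entries are the variables $x_1,\dots,x_{2k^2}$, each used exactly once, and a noncommutative polynomial $p$ in two letters with real coefficients such that the matrix $p(X,Y)$ is a $k\times k$ array whose entries are $p_1,\dots,p_{k^2}$, each exactly once. For an nc polynomial $p$: $\varphi(i,j)$ is the sum of coefficients of monomials of degree $i$ in $X$ and $j$ in $Y$; $\varphi(i,j;X)$ (resp. $\varphi(i,j;Y)$) is the sum of such coefficients over monomials ending in $X$ (resp. $Y$); $\varphi(X;i,j)$ (resp. $\varphi(Y;i,j)$) over monomials beginning with $X$ (resp. $Y$). $\mathcal Q$ is the set of nc polynomials $p$ of degree $d>1$ satisfying at least one of the following three lists. List 1: for some integers $s\ge t+2\ge4$, $\varphi(s,t)\ne0$,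 $\varphi(s,t)\ne\varphi(t,s)$, and at least one of: $t\varphi(s,t)\ne(s+1)\varphi(s+1,t-1)$; $s\varphi(s,t)\ne(t+1)\varphi(s-1,t+1)$; $\varphi(s,t)\ne\varphi(s+1,t-1;X)$ or $\varphi(s,t)\ne\varphi(X;s+1,t-1)$; $\varphi(s,t)\ne\varphi(s-1,t+1;Y)$ or $\varphi(s,t)\ne\varphi(Y;s-1,t+1)$. List 2: for some $t\ge2$, $\varphi(t+1,t)\ne0$, $\varphi(t+1,t)\ne d_3$, $\varphi(t+1,t)\ne d_4$ and $\varphi(t+1,t)\ne\varphi(t,t+1)$, where $d_3$ and $d_4$ are the coefficients in $p$ of the monomials $(XY)^tX$ and $(YX)^tY$. List 3: for some $r\ge2$, $\varphi(r,r)\ne0$, $\varphi(0,2r)=\varphi(2r,0)=0$, $\varphi(r,r)\ne d_1$, $\varphi(r,r)\ne d_2$, where $d_1,d_2$ are the coefficients in $p$ of $(XY)^r$ and $(YX)^r$; and for all $s,t>0$ with $s+t=2r$: $\varphi(s,t;X)\ne0\iff\varphi(s,t;Y)\ne0$, and $\varphi(X;s,t)\ne0\iff\varphi(Y;s,t)\ne0$. *)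

theory Defs
  imports Complex_Main "HOL-Library.Poly_Mapping" "HOL-Combinatorics.Permutations"
begin

text \<open>A commutative polynomial is a finitely supported map from monomials
(finitely supported exponent vectors nat =>0 nat) to real coefficients;
multiplication is the convolution product of HOL-Library.Poly_Mapping.\<close>

type_synonym cpoly = "(nat \<Rightarrow>\<^sub>0 nat) \<Rightarrow>\<^sub>0 real"

definition cvar :: "nat \<Rightarrow> cpoly" where
  "cvar i = Poly_Mapping.single (Poly_Mapping.single i 1) 1"

definition cconst :: "real \<Rightarrow> cpoly" where
  "cconst c = Poly_Mapping.single 0 c"

section \<open>k x k matrices (entries indexed by 0..<k)\<close>

type_synonym 'a sqmat = "nat \<Rightarrow> nat \<Rightarrow> 'a"

definition mat_mul :: "nat \<Rightarrow> 'a::semiring_0 sqmat \<Rightarrow> 'a sqmat \<Rightarrow> 'a sqmat" where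
  "mat_mul k A B = (\<lambda>i j. \<Sum>l<k. A i l * B l j)"

definition mat_id :: "'a::{zero,one} sqmat" where
  "mat_id = (\<lambda>i j. if i = j then 1 else 0)"

definition mat_add :: "'a::plus sqmat \<Rightarrow> 'a sqmat \<Rightarrow> 'a sqmat" where
  "mat_add A B = (\<lambda>i j. A i j + B i j)"

definition mat_smult :: "'a::times \<Rightarrow> 'a sqmat \<Rightarrow> 'a sqmat" where
  "mat_smult c A = (\<lambda>i j. c * A i j)"

definition mat_transpose :: "'a sqmat \<Rightarrow> 'a sqmat" where
  "mat_transpose A = (\<lambda>i j. A j i)"

definition mat_map :: "('a \<Rightarrow> 'b) \<Rightarrow> 'a sqmat \<Rightarrow> 'b sqmat" where
  "mat_map f A = (\<lambda>i j. f (A i j))"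

definition mat_eq :: "nat \<Rightarrow> 'a sqmat \<Rightarrow> 'a sqmat \<Rightarrow> bool" where
  "mat_eq k A B \<longleftrightarrow> (\<forall>i<k. \<forall>j<k. A i j = B i j)"

definition perm_matrix :: "nat \<Rightarrow> real sqmat \<Rightarrow> bool" where
  "perm_matrix k P \<longleftrightarrow>
     (\<exists>\<sigma>. \<sigma> permutes {0..<k} \<and> (\<forall>i<k. \<forall>j<k. P i j = (if \<sigma> i = j then 1 else 0)))"

datatype letter = LX | LY

type_synonym ncpoly = "letter list \<Rightarrow>\<^sub>0 real"

fun word_eval :: "nat \<Rightarrow> 'a::semiring_1 sqmat \<Rightarrow> 'a sqmat \<Rightarrow> letter list \<Rightarrow> 'a sqmat" where
  "word_eval k A B [] = mat_id"
| "word_eval k A B (LX # w) = mat_mul k A (word_eval k A B w)"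
| "word_eval k A B (LY # w) = mat_mul k B (word_eval k A B w)"

definition nc_eval :: "nat \<Rightarrow> ncpoly \<Rightarrow> cpoly sqmat \<Rightarrow> cpoly sqmat \<Rightarrow> cpoly sqmat" where
  "nc_eval k p A B =
     (\<lambda>i j. \<Sum>w\<in>Poly_Mapping.keys p. cconst (Poly_Mapping.lookup p w) * word_eval k A B w i j)"

definition nc_degree :: "ncpoly \<Rightarrow> nat" where
  "nc_degree p = Max (length ` Poly_Mapping.keys p)"

definition cnt :: "letter \<Rightarrow> letter list \<Rightarrow> nat" where
  "cnt a w = length (filter (\<lambda>b. b = a) w)"

definition words_of_type :: "nat \<Rightarrow> nat \<Rightarrow> letter list set" where
  "words_of_type i j = {w. cnt LX w = i \<and> cnt LY w = j}"

definition phi :: "ncpoly \<Rightarrow> nat \<Rightarrow> nat \<Rightarrow> real" where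
  "phi p i j = (\<Sum>w\<in>words_of_type i j. Poly_Mapping.lookup p w)"

definition phi_end :: "ncpoly \<Rightarrow> nat \<Rightarrow> nat \<Rightarrow> letter \<Rightarrow> real" where
  "phi_end p i j a = (\<Sum>w\<in>{w\<in>words_of_type i j. w \<noteq> [] \<and> last w = a}. Poly_Mapping.lookup p w)"

definition phi_begin :: "ncpoly \<Rightarrow> letter \<Rightarrow> nat \<Rightarrow> nat \<Rightarrow> real" where
  "phi_begin p a i j = (\<Sum>w\<in>{w\<in>words_of_type i j. w \<noteq> [] \<and> hd w = a}. Poly_Mapping.lookup p w)"

definition list1 :: "ncpoly \<Rightarrow> bool" where
  "list1 p \<longleftrightarrow> (\<exists>s t::nat. s \<ge> t + 2 \<and> t + 2 \<ge> 4 \<and>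
      phi p s t \<noteq> 0 \<and> phi p s t \<noteq> phi p t s \<and>
      (real t * phi p s t \<noteq> real (s + 1) * phi p (s + 1) (t - 1)
       \<or> real s * phi p s t \<noteq> real (t + 1) * phi p (s - 1) (t + 1)
       \<or> (phi p s t \<noteq> phi_end p (s + 1) (t - 1) LX \<or> phi p s t \<noteq> phi_begin p LX (s + 1) (t - 1))
       \<or> (phi p s t \<noteq> phi_end p (s - 1) (t + 1) LY \<or> phi p s t \<noteq> phi_begin p LY (s - 1) (t + 1))))"

definition list2 :: "ncpoly \<Rightarrow> bool" where
  "list2 p \<longleftrightarrow> (\<exists>t::nat. t \<ge> 2 \<and>
      phi p (t + 1) t \<noteq> 0 \<and>
      phi p (t + 1) t \<noteq> Poly_Mapping.lookup p (concat (replicate t [LX, LY]) @ [LX]) \<and>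
      phi p (t + 1) t \<noteq> Poly_Mapping.lookup p (concat (replicate t [LY, LX]) @ [LY]) \<and>
      phi p (t + 1) t \<noteq> phi p t (t + 1))"

definition list3 :: "ncpoly \<Rightarrow> bool" where
  "list3 p \<longleftrightarrow> (\<exists>r::nat. r \<ge> 2 \<and>
      phi p r r \<noteq> 0 \<and> phi p 0 (2 * r) = 0 \<and> phi p (2 * r) 0 = 0 \<and>
      phi p r r \<noteq> Poly_Mapping.lookup p (concat (replicate r [LX, LY])) \<and>
      phi p r r \<noteq> Poly_Mapping.lookup p (concat (replicate r [LY, LX])) \<and>
      (\<forall>s t. s > 0 \<and> t > 0 \<and> s + t = 2 * r \<longrightarrow>
         (phi_end p s t LX \<noteq> 0 \<longleftrightarrow> phi_end p s t LY \<noteq> 0) \<and>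
         (phi_begin p LX s t \<noteq> 0 \<longleftrightarrow> phi_begin p LY s t \<noteq> 0)))"

definition classQ :: "ncpoly set" where
  "classQ = {p. nc_degree p > 1 \<and> (list1 p \<or> list2 p \<or> list3 p)}"

text \<open>X, Y are given by the index of the variable in each entry (entries 0..<k).\<close>
definition var_matrices :: "nat \<Rightarrow> nat sqmat \<Rightarrow> nat sqmat \<Rightarrow> bool" where
  "var_matrices k X Y \<longleftrightarrow>
     bij_betw (\<lambda>(b, i, j). if b then X i j else Y i j)
       (UNIV \<times> {0..<k} \<times> {0..<k}) {1..2 * k ^ 2}"

definition var_mat :: "nat sqmat \<Rightarrow> cpoly sqmat" where
  "var_mat X = mat_map cvar X"

definition nc_representation ::
    "nat \<Rightarrow> (nat \<Rightarrow> cpoly) \<Rightarrow> ncpoly \<Rightarrow> nat sqmat \<Rightarrow> nat sqmat \<Rightarrow> bool" where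
  "nc_representation k P p X Y \<longleftrightarrow>
     var_matrices k X Y \<and>
     (\<exists>\<tau>. bij_betw \<tau> ({0..<k} \<times> {0..<k}) {1..k ^ 2} \<and>
        (\<forall>i<k. \<forall>j<k. nc_eval k p (var_mat X) (var_mat Y) i j = P (\<tau> (i, j))))"

definition conj_perm :: "nat \<Rightarrow> real sqmat \<Rightarrow> cpoly sqmat \<Rightarrow> cpoly sqmat" where
  "conj_perm k PM A =
     mat_mul k (mat_mul k (mat_transpose (mat_map cconst PM)) A) (mat_map cconst PM)"

end

theory Submission
  imports Defs "HOL-Combinatorics.Multiset_Permutations"
begin

text \<open>The coefficient of a monomial in an entry of \<open>p(X,Y)\<close> counts, with weights, walks in the complete
  bicoloured digraph whose edges are the variables. A monomial $u^s v^t$ with $s, t \ge 2$ only arises from two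
  loops at one vertex or from two opposite edges; each of the three lists excludes opposite edges, so both
  representations have the same pairs of diagonal variables. Let \<open>f\<close> be the commutative image of a homogeneous
  part of \<open>p\<close>. The coefficients $A, B$ of \<open>x\<^sub>i\<^sub>j\<close>, \<open>y\<^sub>i\<^sub>j\<close> in the \<open>(i,j)\<close> entry, with all other off-diagonal
  variables set to zero, satisfy $f(u,v) - f(u',v') = A\,(u-u') + B\,(v-v')$. If \<open>x\<^sub>i\<^sub>j\<close> and \<open>y\<^sub>i\<^sub>j\<close> were
  exchanged relative to the diagonal, then $A = B$ and \<open>f\<close> would depend on $u + v$ only; if the entry depended on
  too few diagonal variables, \<open>f\<close> would be affine. Second order coefficients along $i \to j \to m$ exclude that
  one edge is transposed and an adjacent one is not.\<close>

section \<open>Walks in the grid of variables\<close>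

text \<open>The representations share only the list of polynomials: which entry of one equals which
  entry of the other is an unknown bijection \<open>\<pi>\<close> of positions, and nothing says at
  first that \<open>\<pi>\<close> keeps the diagonal. So the diagonal has to be recognised from
  coefficients. The tool is conservation: head minus tail, summed over the edges of a walk, is end
  minus start, whatever the order of the edges. Unbalanced exponents settle list 1 at once, and list
  3 follows from two off-diagonal coefficients. In list 2 a pair of opposite edges is consistent
  with every such count, and its coefficient belongs to an alternating word of the second
  polynomial. There a count of diagonal against off-diagonal entries leaves only
  \<open>k = 2\<close>, and this case falls to a substitution of signs 1 and -1 for the variables.
  Once the diagonals agree, one homogeneous degree supplied by the list carries the
  argument.\<close>

instantiation letter :: finite
begin
instance
proof
  have "(UNIV :: letter set) = {LX, LY}" by (auto intro: letter.exhaust)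
  then show "finite (UNIV :: letter set)" by (metis finite.emptyI finite.insertI)
qed
end

lemma UNIV_letter: "(UNIV :: letter set) = {LX, LY}"
  by (auto intro: letter.exhaust)

lemma sum_letter: "(\<Sum>a\<in>UNIV. f a) = f LX + f LY" for f :: "letter \<Rightarrow> 'a::comm_monoid_add"
  by (simp add: UNIV_letter)

definition weval :: "nat \<Rightarrow> (letter \<Rightarrow> 'a::semiring_1 sqmat) \<Rightarrow> letter list \<Rightarrow> 'a sqmat" where
  "weval k A w = word_eval k (A LX) (A LY) w"

lemma weval_Nil: "weval k A [] i j = (if i = j then 1 else 0)"
  by (simp add: weval_def mat_id_def)

lemma weval_Cons: "weval k A (a # w) i j = (\<Sum>l<k. A a i l * weval k A w l j)"
  by (cases a) (simp_all add: weval_def mat_mul_def)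

definition words :: "nat \<Rightarrow> letter list set" where
  "words n = {w. length w = n}"

lemma finite_words [simp]: "finite (words n)"
  using finite_lists_length_eq[of "UNIV :: letter set" n] by (simp add: words_def)

text \<open>By bijectivity a variable determines its colour and both ends, so a list of variables
  carries its own colour word and can be tested for being a walk.\<close>

locale grid =
  fixes k :: nat and V :: "nat set" and E :: "letter \<Rightarrow> nat \<Rightarrow> nat \<Rightarrow> nat"
  assumes bij: "bij_betw (\<lambda>(a, i, j). E a i j) (UNIV \<times> {..<k} \<times> {..<k}) V"
begin

definition pos :: "nat \<Rightarrow> letter \<times> nat \<times> nat" where
  "pos = the_inv_into (UNIV \<times> {..<k} \<times> {..<k}) (\<lambda>(a, i, j). E a i j)"

definition lab :: "nat \<Rightarrow> letter" where "lab x = fst (pos x)"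
definition src :: "nat \<Rightarrow> nat" where "src x = fst (snd (pos x))"
definition tgt :: "nat \<Rightarrow> nat" where "tgt x = snd (snd (pos x))"

lemma E_mem [simp]: "i < k \<Longrightarrow> j < k \<Longrightarrow> E a i j \<in> V"
  using bij unfolding bij_betw_def by force

lemma pos_E: "i < k \<Longrightarrow> j < k \<Longrightarrow> pos (E a i j) = (a, i, j)"
  unfolding pos_def using the_inv_into_f_f[OF bij_betw_imp_inj_on[OF bij], of "(a, i, j)"] by simp

lemma lab_E [simp]: "i < k \<Longrightarrow> j < k \<Longrightarrow> lab (E a i j) = a"
  and src_E [simp]: "i < k \<Longrightarrow> j < k \<Longrightarrow> src (E a i j) = i"
  and tgt_E [simp]: "i < k \<Longrightarrow> j < k \<Longrightarrow> tgt (E a i j) = j"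
  by (simp_all add: lab_def src_def tgt_def pos_E)

lemma V_cases:
  assumes "x \<in> V"
  obtains a i j where "i < k" "j < k" "x = E a i j"
  using assms bij unfolding bij_betw_def by force

lemma src_less [simp]: "x \<in> V \<Longrightarrow> src x < k"
  and tgt_less [simp]: "x \<in> V \<Longrightarrow> tgt x < k"
  and E_lab [simp]: "x \<in> V \<Longrightarrow> E (lab x) (src x) (tgt x) = x"
  by (erule V_cases; simp)+

lemma E_eq_iff [simp]:
  assumes "i < k" "j < k" "i' < k" "j' < k"
  shows "E a i j = E b i' j' \<longleftrightarrow> a = b \<and> i = i' \<and> j = j'"
proof
  assume "E a i j = E b i' j'"
  then have "pos (E a i j) = pos (E b i' j')" by simp
  then show "a = b \<and> i = i' \<and> j = j'" using assms by (simp add: pos_E)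
qed simp

lemma finite_V [simp]: "finite V"
  using bij bij_betw_finite by fastforce

primrec walk :: "nat \<Rightarrow> nat list \<Rightarrow> nat \<Rightarrow> bool" where
  "walk i [] j \<longleftrightarrow> i = j"
| "walk i (x # xs) j \<longleftrightarrow> src x = i \<and> walk (tgt x) xs j"

lemma walk_append: "walk i (xs @ ys) j \<longleftrightarrow> (\<exists>l. walk i xs l \<and> walk l ys j)"
  by (induction xs arbitrary: i) auto

text \<open>A commutative monomial is the multiset \<open>M\<close> of its variables; its
  coefficient collects the orderings of \<open>M\<close> that can be walked.\<close>

definition coef :: "(letter list \<Rightarrow> real) \<Rightarrow> nat multiset \<Rightarrow> nat \<Rightarrow> nat \<Rightarrow> real" where
  "coef c M i j = (\<Sum>xs\<in>{xs \<in> permutations_of_multiset M. walk i xs j}. c (map lab xs))"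

definition ev :: "nat \<Rightarrow> (letter list \<Rightarrow> real) \<Rightarrow> (nat \<Rightarrow> real) \<Rightarrow> nat \<Rightarrow> nat \<Rightarrow> real" where
  "ev n c z i j = (\<Sum>w\<in>words n. c w * weval k (\<lambda>a i j. z (E a i j)) w i j)"

definition walks :: "letter list \<Rightarrow> nat \<Rightarrow> nat \<Rightarrow> nat list set" where
  "walks w i j = {xs. set xs \<subseteq> V \<and> map lab xs = w \<and> walk i xs j}"

lemma finite_walks [simp]: "finite (walks w i j)"
proof (rule finite_subset)
  show "walks w i j \<subseteq> {xs. set xs \<subseteq> V \<and> length xs = length w}"
    by (auto simp: walks_def)
  show "finite {xs. set xs \<subseteq> V \<and> length xs = length w}"
    by (rule finite_lists_length_eq) simp
qed

text \<open>The semiring is left general because the expansion is used twice: with real values for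
  \<open>ev\<close> and with \<open>cvar\<close> for the formal coefficients.\<close>

lemma weval_walks:
  fixes z :: "nat \<Rightarrow> 'a::comm_semiring_1"
  assumes "i < k" "j < k"
  shows "weval k (\<lambda>a i j. z (E a i j)) w i j = (\<Sum>xs\<in>walks w i j. prod_list (map z xs))"
  using assms(1)
proof (induction w arbitrary: i)
  case Nil
  have "walks [] i j = (if i = j then {[]} else {})"
    by (auto simp: walks_def)
  then show ?case by (simp add: weval_Nil)
next
  case (Cons a w)
  have "weval k (\<lambda>a i j. z (E a i j)) (a # w) i j
      = (\<Sum>l<k. z (E a i l) * (\<Sum>xs\<in>walks w l j. prod_list (map z xs)))"
    unfolding weval_Cons using Cons.IH by (intro sum.cong) auto
  also have "\<dots> = (\<Sum>(l, xs)\<in>(SIGMA l:{..<k}. walks w l j). z (E a i l) * prod_list (map z xs))"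
    by (simp add: sum_distrib_left sum.Sigma)
  also have "\<dots> = (\<Sum>xs\<in>walks (a # w) i j. prod_list (map z xs))"
  proof (rule sum.reindex_bij_witness[where j = "\<lambda>(l, xs). E a i l # xs" and i = "\<lambda>xs. (tgt (hd xs), tl xs)"])
    fix xs assume xs: "xs \<in> walks (a # w) i j"
    then obtain x ys where "xs = x # ys" by (auto simp: walks_def)
    with xs show "(case (tgt (hd xs), tl xs) of (l, xs) \<Rightarrow> E a i l # xs) = xs"
      and "(tgt (hd xs), tl xs) \<in> (SIGMA l:{..<k}. walks w l j)"
      by (auto simp: walks_def)
  qed (use Cons.prems in \<open>auto simp: walks_def\<close>)
  finally show ?case .
qed

text \<open>Grouping walks by multiset makes the index set depend on \<open>V\<close> and
  \<open>n\<close> alone, so two grids on the same variables can be compared coefficient by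
  coefficient.\<close>

lemma ev_coef:
  assumes "i < k" "j < k"
  shows "ev n c z i j = (\<Sum>M\<in>mset ` {xs. set xs \<subseteq> V \<and> length xs = n}. coef c M i j * (\<Prod>x\<in>#M. z x))"
proof -
  let ?L = "{xs. set xs \<subseteq> V \<and> length xs = n}"
  have fL: "finite ?L" by (rule finite_lists_length_eq) simp
  have "ev n c z i j = (\<Sum>w\<in>words n. \<Sum>xs\<in>walks w i j. c (map lab xs) * prod_list (map z xs))"
    unfolding ev_def using assms
    by (simp add: weval_walks sum_distrib_left) (intro sum.cong refl, simp add: walks_def)
  also have "\<dots> = (\<Sum>(w, xs)\<in>(SIGMA w:words n. walks w i j). c (map lab xs) * prod_list (map z xs))"
    by (simp add: sum.Sigma)
  also have "\<dots> = (\<Sum>xs\<in>{xs\<in>?L. walk i xs j}. c (map lab xs) * prod_list (map z xs))"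
    by (rule sum.reindex_bij_witness[where j = snd and i = "\<lambda>xs. (map lab xs, xs)"])
       (auto simp: walks_def words_def)
  also have "\<dots> = (\<Sum>M\<in>mset ` ?L. \<Sum>xs\<in>{x \<in> {xs\<in>?L. walk i xs j}. mset x = M}. c (map lab xs) * prod_list (map z xs))"
    by (rule sum.group[symmetric]) (auto intro: finite_subset[OF _ fL])
  also have "\<dots> = (\<Sum>M\<in>mset ` ?L. coef c M i j * (\<Prod>x\<in>#M. z x))"
  proof (rule sum.cong[OF refl])
    fix M assume M: "M \<in> mset ` ?L"
    have "{x \<in> {xs\<in>?L. walk i xs j}. mset x = M} = {xs \<in> permutations_of_multiset M. walk i xs j}"
      using M by (auto simp: permutations_of_multiset_def dest: mset_eq_setD mset_eq_length)
    moreover have "prod_list (map z xs) = (\<Prod>x\<in>#M. z x)" if "mset xs = M" for xs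
      using that by (metis mset_map prod_mset_prod_list)
    ultimately show "(\<Sum>xs\<in>{x \<in> {xs\<in>?L. walk i xs j}. mset x = M}. c (map lab xs) * prod_list (map z xs))
       = coef c M i j * (\<Prod>x\<in>#M. z x)"
      unfolding coef_def by (simp add: sum_distrib_right permutations_of_multiset_def)
  qed
  finally show ?thesis .
qed

end

section \<open>Coefficients of formal commutative polynomials\<close>

definition monom_of :: "nat list \<Rightarrow> (nat \<Rightarrow>\<^sub>0 nat)" where
  "monom_of xs = sum_list (map (\<lambda>x. Poly_Mapping.single x 1) xs)"

lemma lookup_monom_of: "Poly_Mapping.lookup (monom_of xs) x = count (mset xs) x"
  by (induction xs) (auto simp: monom_of_def lookup_add lookup_single)

lemma monom_of_eq_iff: "monom_of xs = monom_of ys \<longleftrightarrow> mset xs = mset ys"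
  by (auto simp: poly_mapping_eq_iff fun_eq_iff lookup_monom_of multiset_eq_iff)

lemma prod_list_cvar: "prod_list (map cvar xs) = Poly_Mapping.single (monom_of xs) 1"
  by (induction xs) (simp_all add: monom_of_def cvar_def mult_single)

lemma (in grid) lookup_nc_eval:
  assumes "i < k" "j < k" "set ys \<subseteq> V"
  shows "Poly_Mapping.lookup (nc_eval k p (var_mat (E LX)) (var_mat (E LY)) i j) (monom_of ys)
       = coef (Poly_Mapping.lookup p) (mset ys) i j"
proof -
  let ?K = "Poly_Mapping.keys p"
  have w: "word_eval k (var_mat (E LX)) (var_mat (E LY)) w i j
      = (\<Sum>xs\<in>walks w i j. Poly_Mapping.single (monom_of xs) 1)" for w
    using weval_walks[of i j cvar w] assms
    by (simp add: weval_def var_mat_def mat_map_def[abs_def] prod_list_cvar)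
  have S: "snd ` (SIGMA w:?K. {xs\<in>walks w i j. mset xs = mset ys})
      = {xs \<in> permutations_of_multiset (mset ys). walk i xs j \<and> map lab xs \<in> ?K}"
  proof (intro equalityI subsetI)
    fix xs assume xs: "xs \<in> {xs \<in> permutations_of_multiset (mset ys). walk i xs j \<and> map lab xs \<in> ?K}"
    then have m: "mset xs = mset ys" and k: "map lab xs \<in> ?K" and w: "walk i xs j"
      by (simp_all add: permutations_of_multiset_def)
    have "set xs \<subseteq> V"
      using mset_eq_setD[OF m] assms(3) by blast
    with m k w have "(map lab xs, xs) \<in> (SIGMA w:?K. {xs\<in>walks w i j. mset xs = mset ys})"
      by (simp add: walks_def)
    then show "xs \<in> snd ` (SIGMA w:?K. {xs\<in>walks w i j. mset xs = mset ys})"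
      by (rule rev_image_eqI) simp
  next
    fix xs assume "xs \<in> snd ` (SIGMA w:?K. {xs\<in>walks w i j. mset xs = mset ys})"
    then show "xs \<in> {xs \<in> permutations_of_multiset (mset ys). walk i xs j \<and> map lab xs \<in> ?K}"
      by (auto simp: walks_def permutations_of_multiset_def)
  qed
  have "Poly_Mapping.lookup (nc_eval k p (var_mat (E LX)) (var_mat (E LY)) i j) (monom_of ys)
     = (\<Sum>w\<in>?K. \<Sum>xs\<in>walks w i j. if mset xs = mset ys then Poly_Mapping.lookup p w else 0)"
    unfolding nc_eval_def w
    by (simp add: lookup_sum sum_distrib_left cconst_def mult_single lookup_single when_def monom_of_eq_iff)
  also have "\<dots> = (\<Sum>(w, xs)\<in>(SIGMA w:?K. walks w i j). if mset xs = mset ys then Poly_Mapping.lookup p w else 0)"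
    by (simp add: sum.Sigma)
  also have "\<dots> = (\<Sum>(w, xs)\<in>(SIGMA w:?K. {xs\<in>walks w i j. mset xs = mset ys}). Poly_Mapping.lookup p w)"
    by (rule sum.mono_neutral_cong_right) (auto split: if_splits)
  \<comment> \<open>The second component is injective here because a walk determines its colour
    word.\<close>
  also have "\<dots> = (\<Sum>xs\<in>snd ` (SIGMA w:?K. {xs\<in>walks w i j. mset xs = mset ys}). Poly_Mapping.lookup p (map lab xs))"
    by (subst sum.reindex) (auto simp: walks_def inj_on_def intro!: sum.cong)
  also have "\<dots> = coef (Poly_Mapping.lookup p) (mset ys) i j"
    unfolding coef_def S by (rule sum.mono_neutral_left) (auto simp: in_keys_iff)
  finally show ?thesis .
qed

section \<open>Fox derivatives of words\<close>

definition word_prod :: "(letter \<Rightarrow> real) \<Rightarrow> letter list \<Rightarrow> real" where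
  "word_prod g w = prod_list (map g w)"

lemma word_prod_simps [simp]: "word_prod g [] = 1" "word_prod g (a # w) = g a * word_prod g w"
  by (simp_all add: word_prod_def)

text \<open>Each occurrence of \<open>a\<close> contributes the product of the preceding letters at \<open>g\<close> and of the
  following letters at \<open>h\<close>: the upper right entry of the word at $2 \times 2$ upper triangular matrices.\<close>

primrec fox_word :: "letter \<Rightarrow> (letter \<Rightarrow> real) \<Rightarrow> (letter \<Rightarrow> real) \<Rightarrow> letter list \<Rightarrow> real" where
  "fox_word a g h [] = 0"
| "fox_word a g h (b # w) = g b * fox_word a g h w + (if a = b then word_prod h w else 0)"

primrec fox_word2 :: "letter \<Rightarrow> letter \<Rightarrow> (letter \<Rightarrow> real) \<Rightarrow> (letter \<Rightarrow> real) \<Rightarrow> (letter \<Rightarrow> real) \<Rightarrow> letter list \<Rightarrow> real" where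
  "fox_word2 a b g h l [] = 0"
| "fox_word2 a b g h l (d # w) = g d * fox_word2 a b g h l w + (if a = d then fox_word b h l w else 0)"

text \<open>Hybrid products, with \<open>g\<close> on a prefix and \<open>h\<close> on the rest,
  lead from \<open>h\<close> to \<open>g\<close> one position at a time; each step contributes one
  occurrence of a letter.\<close>

lemma fox_word_telescope: "(\<Sum>a\<in>UNIV. fox_word a g h w * (g a - h a)) = word_prod g w - word_prod h w"
proof (induction w)
  case (Cons b w)
  have "(\<Sum>a\<in>UNIV. fox_word a g h (b # w) * (g a - h a))
      = g b * (\<Sum>a\<in>UNIV. fox_word a g h w * (g a - h a)) + word_prod h w * (g b - h b)"
    by (cases b) (simp_all add: sum_letter algebra_simps)
  also have "\<dots> = word_prod g (b # w) - word_prod h (b # w)"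
    unfolding Cons by (simp add: algebra_simps)
  finally show ?case .
qed (simp add: sum_letter)

text \<open>\<open>fox_word2\<close> marks an \<open>a\<close> and a later \<open>b\<close>, with
  \<open>g\<close>, \<open>h\<close>, \<open>l\<close> before, between and after them; summing over
  \<open>b\<close> telescopes the stretch behind the marked \<open>a\<close>.\<close>

lemma fox_word2_telescope: "(\<Sum>b\<in>UNIV. fox_word2 a b g h l w * (h b - l b)) = fox_word a g h w - fox_word a g l w"
proof (induction w)
  case (Cons d w)
  have "(\<Sum>b\<in>UNIV. fox_word2 a b g h l (d # w) * (h b - l b))
      = g d * (\<Sum>b\<in>UNIV. fox_word2 a b g h l w * (h b - l b))
        + (if a = d then \<Sum>b\<in>UNIV. fox_word b h l w * (h b - l b) else 0)"
    by (simp add: sum_letter algebra_simps)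
  also have "\<dots> = fox_word a g h (d # w) - fox_word a g l (d # w)"
    unfolding Cons.IH fox_word_telescope by (simp add: algebra_simps)
  finally show ?case .
qed (simp add: sum_letter)

definition comm_part :: "nat \<Rightarrow> (letter list \<Rightarrow> real) \<Rightarrow> (letter \<Rightarrow> real) \<Rightarrow> real" where
  "comm_part n c g = (\<Sum>w\<in>words n. c w * word_prod g w)"

definition fox_deriv :: "nat \<Rightarrow> (letter list \<Rightarrow> real) \<Rightarrow> letter \<Rightarrow> (letter \<Rightarrow> real) \<Rightarrow> (letter \<Rightarrow> real) \<Rightarrow> real" where
  "fox_deriv n c a g h = (\<Sum>w\<in>words n. c w * fox_word a g h w)"

definition fox_deriv2 :: "nat \<Rightarrow> (letter list \<Rightarrow> real) \<Rightarrow> letter \<Rightarrow> letter \<Rightarrow> (letter \<Rightarrow> real) \<Rightarrow> (letter \<Rightarrow> real) \<Rightarrow> (letter \<Rightarrow> real) \<Rightarrow> real" where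
  "fox_deriv2 n c a b g h l = (\<Sum>w\<in>words n. c w * fox_word2 a b g h l w)"

lemma fox_deriv_telescope: "(\<Sum>a\<in>UNIV. fox_deriv n c a g h * (g a - h a)) = comm_part n c g - comm_part n c h"
proof -
  have "comm_part n c g - comm_part n c h = (\<Sum>w\<in>words n. c w * (\<Sum>a\<in>UNIV. fox_word a g h w * (g a - h a)))"
    unfolding comm_part_def fox_word_telescope by (simp add: algebra_simps sum_subtractf)
  also have "\<dots> = (\<Sum>w\<in>words n. \<Sum>a\<in>UNIV. c w * (fox_word a g h w * (g a - h a)))"
    by (simp add: sum_distrib_left)
  finally show ?thesis
    unfolding fox_deriv_def sum_distrib_right by (subst sum.swap) (simp add: mult.assoc)
qed

lemma fox_deriv2_telescope: "(\<Sum>b\<in>UNIV. fox_deriv2 n c a b g h l * (h b - l b)) = fox_deriv n c a g h - fox_deriv n c a g l"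
proof -
  have "fox_deriv n c a g h - fox_deriv n c a g l = (\<Sum>w\<in>words n. c w * (\<Sum>b\<in>UNIV. fox_word2 a b g h l w * (h b - l b)))"
    unfolding fox_deriv_def fox_word2_telescope by (simp add: algebra_simps sum_subtractf)
  also have "\<dots> = (\<Sum>w\<in>words n. \<Sum>b\<in>UNIV. c w * (fox_word2 a b g h l w * (h b - l b)))"
    by (simp add: sum_distrib_left)
  finally show ?thesis
    unfolding fox_deriv2_def sum_distrib_right by (subst sum.swap) (simp add: mult.assoc)
qed

text \<open>Matrices supported on a preorder are closed under products (an incidence algebra);
  reflexivity covers the empty word.\<close>

lemma weval_support:
  assumes "\<And>a i j. i < k \<Longrightarrow> j < k \<Longrightarrow> A a i j \<noteq> (0::real) \<Longrightarrow> R i j"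
    and "reflp R" "transp R" "j < k" "i < k" "weval k A w i j \<noteq> 0"
  shows "R i j"
  using assms(5,6)
proof (induction w arbitrary: i)
  case Nil
  then show ?case using assms(2) by (auto simp: weval_Nil reflp_def split: if_splits)
next
  case (Cons a w)
  then obtain l where l: "l < k" "A a i l * weval k A w l j \<noteq> 0"
    unfolding weval_Cons by (metis (no_types, lifting) lessThan_iff sum.neutral)
  then have "R i l" "R l j" using assms(1) Cons by auto
  then show ?case using assms(3) by (meson transpD)
qed

lemma weval_row_diag:
  assumes "\<And>b l. l < k \<Longrightarrow> l \<noteq> j \<Longrightarrow> A b j l = (0::real)" "j < k"
  shows "weval k A w j m = (if m = j then word_prod (\<lambda>b. A b j j) w else 0)"
proof (induction w)
  case (Cons a w)
  have "weval k A (a # w) j m = (\<Sum>l\<in>{j}. A a j l * weval k A w l m)"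
    unfolding weval_Cons by (rule sum.mono_neutral_right) (use assms in auto)
  with Cons show ?case by simp
qed (simp add: weval_Nil)

lemma weval_row_two:
  assumes "\<And>b l. l < k \<Longrightarrow> l \<notin> {i, j} \<Longrightarrow> A b i l = (0::real)" "i < k" "j < k" "i \<noteq> j"
    and "\<And>b. A b i j = (if a = b then 1 else 0)"
  shows "weval k A (b # w) i m = A b i i * weval k A w i m + (if a = b then weval k A w j m else 0)"
proof -
  have "weval k A (b # w) i m = (\<Sum>l\<in>{i, j}. A b i l * weval k A w l m)"
    unfolding weval_Cons by (rule sum.mono_neutral_right) (use assms in auto)
  with assms(4,5) show ?thesis by simp
qed

text \<open>From \<open>i\<close> one can only loop or take the single edge of colour
  \<open>a\<close> to \<open>j\<close>, and \<open>j\<close> can only loop; a walk from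
  \<open>i\<close> to \<open>j\<close> is thus a word with one marked \<open>a\<close>.\<close>

lemma weval_fox:
  assumes "\<And>b l. l < k \<Longrightarrow> l \<notin> {i, j} \<Longrightarrow> A b i l = (0::real)" "i < k" "j < k" "i \<noteq> j"
    and "\<And>b. A b i j = (if a = b then 1 else 0)"
    and "\<And>b l. l < k \<Longrightarrow> l \<noteq> j \<Longrightarrow> A b j l = 0"
  shows "weval k A w i j = fox_word a (\<lambda>b. A b i i) (\<lambda>b. A b j j) w"
proof (induction w)
  case (Cons b w)
  have "weval k A w j j = word_prod (\<lambda>b. A b j j) w"
    using weval_row_diag[of k j A w j] assms(3,6) by simp
  moreover have "weval k A (b # w) i j = A b i i * weval k A w i j + (if a = b then weval k A w j j else 0)"
    by (rule weval_row_two) (use assms in auto)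
  ultimately show ?case using Cons by simp
qed (simp add: weval_Nil assms(4))

lemma weval_fox2:
  assumes "\<And>b l. l < k \<Longrightarrow> l \<notin> {i, j} \<Longrightarrow> A b i l = (0::real)" "i < k" "j < k" "i \<noteq> j"
    and "\<And>b. A b i j = (if a = b then 1 else 0)"
    and "\<And>b l. l < k \<Longrightarrow> l \<notin> {j, m} \<Longrightarrow> A b j l = (0::real)" "m < k" "j \<noteq> m" "i \<noteq> m"
    and "\<And>b. A b j m = (if a' = b then 1 else 0)"
    and "\<And>b l. l < k \<Longrightarrow> l \<noteq> m \<Longrightarrow> A b m l = 0"
  shows "weval k A w i m = fox_word2 a a' (\<lambda>b. A b i i) (\<lambda>b. A b j j) (\<lambda>b. A b m m) w"
proof (induction w)
  case (Cons b w)
  have "weval k A w j m = fox_word a' (\<lambda>b. A b j j) (\<lambda>b. A b m m) w"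
    by (rule weval_fox) (use assms in auto)
  moreover have "weval k A (b # w) i m = A b i i * weval k A w i m + (if a = b then weval k A w j m else 0)"
    by (rule weval_row_two) (use assms in auto)
  ultimately show ?case using Cons by simp
qed (simp add: weval_Nil assms(9))

section \<open>Values at diagonal points with one or two extra edges\<close>

context grid
begin

definition diagonal :: "(nat \<Rightarrow> real) \<Rightarrow> bool" where
  "diagonal z \<longleftrightarrow> (\<forall>a i j. i < k \<longrightarrow> j < k \<longrightarrow> i \<noteq> j \<longrightarrow> z (E a i j) = 0)"

definition loop_vals :: "(nat \<Rightarrow> real) \<Rightarrow> nat \<Rightarrow> letter \<Rightarrow> real" where
  "loop_vals z i = (\<lambda>a. z (E a i i))"

lemma ev_diag:
  assumes "diagonal z" "i < k"
  shows "ev n c z i i = comm_part n c (loop_vals z i)"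
  unfolding ev_def comm_part_def loop_vals_def
  by (intro sum.cong refl, subst weval_row_diag) (use assms in \<open>auto simp: diagonal_def\<close>)

lemma ev_one:
  assumes "diagonal z" "i < k" "j < k" "i \<noteq> j"
  shows "ev n c (z(E a i j := 1)) i j = fox_deriv n c a (loop_vals z i) (loop_vals z j)"
  unfolding ev_def fox_deriv_def loop_vals_def
  by (intro sum.cong refl, subst weval_fox[where a = a]) (use assms in \<open>auto simp: diagonal_def\<close>)

text \<open>The identity together with the single pair \<open>(i, j)\<close> is already transitive,
  so no other off-diagonal position is reached.\<close>

lemma ev_one_other:
  assumes "diagonal z" "i < k" "j < k" "i \<noteq> j" "i' < k" "j' < k" "i' \<noteq> j'" "(i, j) \<noteq> (i', j')"
  shows "ev n c (z(E a i j := 1)) i' j' = 0"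
proof -
  let ?R = "\<lambda>x y. x = y \<or> x = i \<and> y = j"
  have "weval k (\<lambda>b i' j'. (z(E a i j := 1)) (E b i' j')) w i' j' = 0" for w
  proof (rule ccontr)
    assume *: "weval k (\<lambda>b i' j'. (z(E a i j := 1)) (E b i' j')) w i' j' \<noteq> 0"
    have "?R i' j'"
      by (rule weval_support[OF _ _ _ _ _ *])
         (use assms in \<open>auto simp: diagonal_def reflp_def transp_def split: if_splits\<close>)
    then show False using assms by auto
  qed
  then show ?thesis unfolding ev_def by simp
qed

lemma ev_two:
  assumes "diagonal z" "i < k" "j < k" "m < k" "i \<noteq> j" "j \<noteq> m" "i \<noteq> m"
  shows "ev n c (z(E a i j := 1, E b j m := 1)) i m
    = fox_deriv2 n c a b (loop_vals z i) (loop_vals z j) (loop_vals z m)"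
  unfolding ev_def fox_deriv2_def loop_vals_def
  by (intro sum.cong refl, subst weval_fox2[where j = j and a = a and a' = b])
     (use assms in \<open>auto simp: diagonal_def\<close>)

text \<open>Both extra edges end at \<open>j\<close>, which has no way out, so \<open>i\<close> and
  \<open>m\<close> cannot reach each other.\<close>

lemma ev_two_anti:
  assumes "diagonal z" "i < k" "j < k" "m < k" "i \<noteq> j" "j \<noteq> m" "i \<noteq> m"
    and "(i', m') = (i, m) \<or> (i', m') = (m, i)"
  shows "ev n c (z(E a i j := 1, E b m j := 1)) i' m' = 0"
proof -
  let ?R = "\<lambda>x y. x = y \<or> y = j \<and> (x = i \<or> x = m)"
  let ?z = "z(E a i j := 1, E b m j := 1)"
  have "weval k (\<lambda>b i' j'. ?z (E b i' j')) w i' m' = 0" for w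
  proof (rule ccontr)
    assume *: "weval k (\<lambda>b i' j'. ?z (E b i' j')) w i' m' \<noteq> 0"
    have "?R i' m'"
      by (rule weval_support[OF _ _ _ _ _ *])
         (use assms in \<open>auto simp: diagonal_def reflp_def transp_def split: if_splits\<close>)
    then show False using assms by auto
  qed
  then show ?thesis unfolding ev_def by simp
qed

definition diag_val :: "(nat \<Rightarrow> letter \<Rightarrow> real) \<Rightarrow> nat \<Rightarrow> real" where
  "diag_val G x = (if src x = tgt x then G (src x) (lab x) else 0)"

lemma diagonal_diag_val [simp]: "diagonal (diag_val G)"
  by (simp add: diagonal_def diag_val_def)

lemma loop_vals_diag_val [simp]: "i < k \<Longrightarrow> loop_vals (diag_val G) i = G i"
  by (simp add: loop_vals_def diag_val_def fun_eq_iff)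

end

section \<open>Rigidity once the diagonals agree\<close>

definition swap_letter :: "letter \<Rightarrow> letter" where
  "swap_letter a = (case a of LX \<Rightarrow> LY | LY \<Rightarrow> LX)"

lemma swap_letter_simps [simp]: "swap_letter LX = LY" "swap_letter LY = LX" "swap_letter (swap_letter a) = a" "swap_letter a \<noteq> a" "a \<noteq> swap_letter a"
  by (auto simp: swap_letter_def split: letter.splits)

lemma neq_letter_iff: "a \<noteq> b \<longleftrightarrow> a = swap_letter b"
  by (cases a; cases b) auto

lemma inj_letter_cases:
  fixes f :: "letter \<Rightarrow> letter"
  assumes "inj f"
  shows "f = id \<or> f = swap_letter"
proof -
  have "f LX \<noteq> f LY" using assms by (auto dest: injD)
  then have "(f LX = LX \<and> f LY = LY) \<or> (f LX = LY \<and> f LY = LX)"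
    by (metis letter.exhaust)
  then show ?thesis
    by (metis (full_types) eq_id_iff ext letter.exhaust swap_letter_simps(1,2))
qed

text \<open>The situation after the vertices of the second grid have been renamed. The last three
  assumptions are non-degeneracy of the commutative image: \<open>not_affine\<close> makes the Fox
  derivatives depend on both ends of an edge, \<open>depends\<close> makes them nonzero in each
  colour, \<open>not_sum\<close> forbids exchanging the colours.\<close>

locale matched = A: grid k V E + B: grid k V E'
  for k :: nat and V :: "nat set" and E E' :: "letter \<Rightarrow> nat \<Rightarrow> nat \<Rightarrow> nat" +
  fixes n :: nat and c c' :: "letter list \<Rightarrow> real" and \<pi> :: "nat \<times> nat \<Rightarrow> nat \<times> nat"
  assumes pi_bij: "bij_betw \<pi> ({..<k} \<times> {..<k}) ({..<k} \<times> {..<k})"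
    and ev_eq: "i < k \<Longrightarrow> j < k \<Longrightarrow> A.ev n c z i j = B.ev n c' z (fst (\<pi> (i, j))) (snd (\<pi> (i, j)))"
    and pi_diag: "i < k \<Longrightarrow> \<pi> (i, i) = (i, i)"
    and loops: "i < k \<Longrightarrow> range (\<lambda>a. E a i i) = range (\<lambda>a. E' a i i)"
    and not_affine: "\<not> (\<exists>\<alpha> \<beta>. \<forall>g. comm_part n c g = \<alpha> + (\<Sum>a\<in>UNIV. \<beta> a * g a))"
    and depends: "\<exists>g h. (\<forall>b. b \<noteq> a \<longrightarrow> g b = h b) \<and> comm_part n c g \<noteq> comm_part n c h"
    and not_sum: "\<exists>g h. g LX + g LY = h LX + h LY \<and> comm_part n c g \<noteq> comm_part n c h"
begin

lemma offdiag_var: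
  assumes "i < k" "j < k" "i \<noteq> j"
  obtains a i' j' where "i' < k" "j' < k" "i' \<noteq> j'" "E' b i j = E a i' j'"
proof -
  have "E' b i j \<in> V" using assms by simp
  then obtain a i' j' where *: "i' < k" "j' < k" "E' b i j = E a i' j'"
    by (rule A.V_cases)
  have "i' \<noteq> j'"
  proof
    assume "i' = j'"
    then have "E' b i j \<in> range (\<lambda>a. E' a i' i')"
      using * loops by blast
    then show False using * assms by auto
  qed
  with * that show thesis by blast
qed

lemma offdiag_var':
  assumes "i < k" "j < k" "i \<noteq> j"
  obtains a i' j' where "i' < k" "j' < k" "i' \<noteq> j'" "E b i j = E' a i' j'"
proof -
  have "E b i j \<in> V" using assms by simp
  then obtain a i' j' where *: "i' < k" "j' < k" "E b i j = E' a i' j'"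
    by (rule B.V_cases)
  have "i' \<noteq> j'"
  proof
    assume "i' = j'"
    then have "E b i j \<in> range (\<lambda>a. E a i' i')"
      using * loops by blast
    then show False using * assms by auto
  qed
  with * that show thesis by blast
qed

lemma diagonal_iff: "A.diagonal z \<longleftrightarrow> B.diagonal z"
proof
  assume "A.diagonal z"
  then show "B.diagonal z" unfolding A.diagonal_def B.diagonal_def
    by (metis offdiag_var)
next
  assume "B.diagonal z"
  then show "A.diagonal z" unfolding A.diagonal_def B.diagonal_def
    by (metis offdiag_var')
qed

lemma pi_less:
  assumes "i < k" "j < k"
  shows "fst (\<pi> (i, j)) < k" "snd (\<pi> (i, j)) < k"
proof -
  have "\<pi> (i, j) \<in> {..<k} \<times> {..<k}" using bij_betwE[OF pi_bij] assms by blast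
  then show "fst (\<pi> (i, j)) < k" "snd (\<pi> (i, j)) < k" by (simp_all add: mem_Times_iff)
qed

lemma pi_offdiag:
  assumes "i < k" "j < k" "i \<noteq> j"
  shows "fst (\<pi> (i, j)) \<noteq> snd (\<pi> (i, j))"
proof
  let ?l = "fst (\<pi> (i, j))"
  assume "?l = snd (\<pi> (i, j))"
  then have "\<pi> (i, j) = \<pi> (?l, ?l)"
    using pi_diag[of ?l] pi_less[OF assms(1,2)] by (simp add: prod_eq_iff)
  then have "(i, j) = (?l, ?l)"
    using bij_betw_imp_inj_on[OF pi_bij] pi_less[OF assms(1,2)] assms
    unfolding inj_on_def by blast
  with assms show False by simp
qed

lemma fox_deriv_nonzero: "\<exists>g h. fox_deriv n c a g h \<noteq> 0"
proof (rule ccontr)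
  assume "\<not> ?thesis"
  then have *: "fox_deriv n c a g h = 0" for g h by blast
  obtain g h where gh: "\<And>b. b \<noteq> a \<Longrightarrow> g b = h b" "comm_part n c g \<noteq> comm_part n c h"
    using depends by blast
  have "comm_part n c g - comm_part n c h = (\<Sum>b\<in>UNIV. fox_deriv n c b g h * (g b - h b))"
    by (simp add: fox_deriv_telescope)
  also have "\<dots> = 0"
    by (rule sum.neutral) (use * gh(1) in force)
  finally show False using gh(2) by simp
qed

text \<open>Derivatives blind to \<open>g\<close> could be frozen at \<open>g = 0\<close>, and
  telescoping from \<open>h = 0\<close> would make the commutative image affine.\<close>

lemma fox_deriv_depends_fst: "\<exists>a g g' h. fox_deriv n c a g h \<noteq> fox_deriv n c a g' h"
proof (rule ccontr)
  assume "\<not> ?thesis"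
  then have *: "fox_deriv n c a g h = fox_deriv n c a (\<lambda>_. 0) h" for a g h by blast
  let ?\<beta> = "\<lambda>a. fox_deriv n c a (\<lambda>_. 0) (\<lambda>_. 0)"
  have "comm_part n c g = comm_part n c (\<lambda>_. 0) + (\<Sum>a\<in>UNIV. ?\<beta> a * g a)" for g
    using fox_deriv_telescope[of n c g "\<lambda>_. 0"] by (simp add: *[of _ g])
  then have "\<exists>\<alpha> \<beta>. \<forall>g. comm_part n c g = \<alpha> + (\<Sum>a\<in>UNIV. \<beta> a * g a)"
    by (intro exI[of _ "comm_part n c (\<lambda>_. 0)"] exI[of _ ?\<beta>] allI)
  with not_affine show False by contradiction
qed

lemma fox_deriv_depends_snd: "\<exists>a g h h'. fox_deriv n c a g h \<noteq> fox_deriv n c a g h'"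
proof (rule ccontr)
  assume "\<not> ?thesis"
  then have *: "fox_deriv n c a g h = fox_deriv n c a g (\<lambda>_. 0)" for a g h by blast
  let ?\<beta> = "\<lambda>a. fox_deriv n c a (\<lambda>_. 0) (\<lambda>_. 0)"
  have "comm_part n c g = comm_part n c (\<lambda>_. 0) + (\<Sum>a\<in>UNIV. ?\<beta> a * g a)" for g
  proof -
    have "comm_part n c (\<lambda>_. 0) - comm_part n c g = (\<Sum>a\<in>UNIV. fox_deriv n c a (\<lambda>_. 0) (\<lambda>_. 0) * (0 - g a))"
      using fox_deriv_telescope[of n c "\<lambda>_. 0" g] by (simp add: *[of _ _ g])
    then show ?thesis by (simp add: sum_negf)
  qed
  then have "\<exists>\<alpha> \<beta>. \<forall>g. comm_part n c g = \<alpha> + (\<Sum>a\<in>UNIV. \<beta> a * g a)"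
    by (intro exI[of _ "comm_part n c (\<lambda>_. 0)"] exI[of _ ?\<beta>] allI)
  with not_affine show False by contradiction
qed

text \<open>One edge is switched on over a diagonal point: the answer is a Fox derivative in the
  loop values at the two ends, and it must be the same function when read in the other grid.\<close>

lemma offdiag_matching:
  assumes ij: "i < k" "j < k" "i \<noteq> j"
  shows "\<pi> (i, j) = (i, j) \<or> \<pi> (i, j) = (j, i)"
    and "\<exists>b. E a i j = E' b (fst (\<pi> (i, j))) (snd (\<pi> (i, j)))"
proof -
  define i' j' where "i' = fst (\<pi> (i, j))" and "j' = snd (\<pi> (i, j))"
  have i'j': "i' < k" "j' < k" "i' \<noteq> j'"
    using ij pi_less pi_offdiag by (auto simp: i'_def j'_def)
  \<comment> \<open>Were the variable outside the entry \<open>(i', j')\<close>, that entry would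
    vanish at all these points.\<close>
  have ex: "\<exists>b. E a i j = E' b i' j'" for a
  proof (rule ccontr)
    assume neg: "\<nexists>b. E a i j = E' b i' j'"
    obtain b l m where lm: "l < k" "m < k" "l \<noteq> m" "E a i j = E' b l m"
      using offdiag_var'[OF ij] .
    have "fox_deriv n c a g h = 0" for g h
    proof -
      let ?z = "A.diag_val (\<lambda>l. if l = i then g else h)"
      have "fox_deriv n c a g h = A.ev n c (?z(E a i j := 1)) i j"
        using ij by (simp add: A.ev_one)
      also have "\<dots> = B.ev n c' (?z(E' b l m := 1)) i' j'"
        using ij by (simp add: ev_eq i'_def j'_def lm(4))
      also have "\<dots> = 0"
        by (rule B.ev_one_other) (use lm i'j' neg in \<open>auto simp: diagonal_iff[symmetric]\<close>)
      finally show ?thesis .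
    qed
    with fox_deriv_nonzero show False by blast
  qed
  then show "\<exists>b. E a i j = E' b (fst (\<pi> (i, j))) (snd (\<pi> (i, j)))"
    by (simp add: i'_def j'_def)
  \<comment> \<open>Read in the second grid, the value sees only the loops at \<open>i'\<close> and
    \<open>j'\<close>; hence \<open>i\<close> and \<open>j\<close> must both be among these
    two.\<close>
  have local: "fox_deriv n c a (G i) (G j) = fox_deriv n c a (H i) (H j)"
    if GH: "G i' = H i'" "G j' = H j'" for a G H
  proof -
    obtain b where b: "E a i j = E' b i' j'" using ex by blast
    have eq: "fox_deriv n c a (G i) (G j) = fox_deriv n c' b (B.loop_vals (A.diag_val G) i') (B.loop_vals (A.diag_val G) j')" for G
    proof -
      have "fox_deriv n c a (G i) (G j) = A.ev n c ((A.diag_val G)(E a i j := 1)) i j"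
        using ij by (simp add: A.ev_one)
      also have "\<dots> = B.ev n c' ((A.diag_val G)(E' b i' j' := 1)) i' j'"
        using ij by (simp add: ev_eq i'_def j'_def b)
      also have "\<dots> = fox_deriv n c' b (B.loop_vals (A.diag_val G) i') (B.loop_vals (A.diag_val G) j')"
        using i'j' by (simp add: B.ev_one diagonal_iff[symmetric])
      finally show ?thesis .
    qed
    have "B.loop_vals (A.diag_val G) m = B.loop_vals (A.diag_val H) m" if m: "m < k" "G m = H m" for m
    proof
      fix d
      have "E' d m m \<in> range (\<lambda>a. E a m m)" using loops m(1) by blast
      then obtain d' where "E' d m m = E d' m m" by auto
      then show "B.loop_vals (A.diag_val G) m d = B.loop_vals (A.diag_val H) m d"
        using m by (simp add: B.loop_vals_def A.diag_val_def)
    qed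
    then show ?thesis using eq i'j' GH by simp
  qed
  have "i = i' \<or> i = j'"
  proof (rule ccontr)
    assume neg: "\<not> (i = i' \<or> i = j')"
    obtain a g g' h where "fox_deriv n c a g h \<noteq> fox_deriv n c a g' h"
      using fox_deriv_depends_fst by blast
    with local[of "\<lambda>l. if l = i then g else h" "\<lambda>l. if l = i then g' else h" a] neg ij
    show False by auto
  qed
  moreover have "j = i' \<or> j = j'"
  proof (rule ccontr)
    assume neg: "\<not> (j = i' \<or> j = j')"
    obtain a g h h' where "fox_deriv n c a g h \<noteq> fox_deriv n c a g h'"
      using fox_deriv_depends_snd by blast
    with local[of "\<lambda>l. if l = j then h else g" "\<lambda>l. if l = j then h' else g" a] neg ij
    show False by auto
  qed
  moreover have "\<pi> (i, j) = (i', j')" by (simp add: i'_def j'_def)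
  ultimately show "\<pi> (i, j) = (i, j) \<or> \<pi> (i, j) = (j, i)" using ij by auto
qed

definition loop_lab :: "nat \<Rightarrow> letter \<Rightarrow> letter" where
  "loop_lab i a = B.lab (E a i i)"

lemma loop_lab: "i < k \<Longrightarrow> E a i i = E' (loop_lab i a) i i"
proof -
  assume "i < k"
  then have "E a i i \<in> range (\<lambda>a. E' a i i)" using loops by blast
  then obtain b where "E a i i = E' b i i" by auto
  with \<open>i < k\<close> show ?thesis by (simp add: loop_lab_def)
qed

lemma inj_loop_lab: "i < k \<Longrightarrow> inj (loop_lab i)"
  by (rule injI) (metis A.E_eq_iff loop_lab)

text \<open>If two orientations disagreed, the Fox identities for both representations would force
  the two partial derivatives of the commutative image to coincide.\<close>

lemma not_sum_invariant:
  assumes "\<And>g h. g LX + g LY = h LX + h LY \<Longrightarrow> P g h \<Longrightarrow> fox_deriv n c LX g h = fox_deriv n c LY g h"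
    and "\<And>g h. g LX + g LY = h LX + h LY \<Longrightarrow> \<exists>m. m LX + m LY = g LX + g LY \<and> P g m \<and> P h m
           \<or> m LX + m LY = g LX + g LY \<and> P m g \<and> P m h"
  shows False
proof -
  have eq: "comm_part n c g = comm_part n c h" if "g LX + g LY = h LX + h LY" "P g h" for g h
  proof -
    have "comm_part n c g - comm_part n c h = fox_deriv n c LX g h * (g LX + g LY - (h LX + h LY))"
      using assms(1)[OF that] fox_deriv_telescope[of n c g h] by (simp add: sum_letter algebra_simps)
    with that show ?thesis by simp
  qed
  obtain g h where gh: "g LX + g LY = h LX + h LY" "comm_part n c g \<noteq> comm_part n c h"
    using not_sum by blast
  then show False using assms(2)[OF gh(1)] eq by metis
qed

text \<open>Telescoping in either grid gives the same difference of values of the commutative image,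
  once with the original letters and once with the letters permuted by the edge against the loops. A
  mismatch equates the two Fox derivatives off a hyperplane.\<close>

lemma orientation:
  assumes ij: "i < k" "j < k" "i \<noteq> j" and b: "E a i j = E' b (fst (\<pi> (i, j))) (snd (\<pi> (i, j)))"
  shows "b = loop_lab i a" "b = loop_lab j a"
proof -
  define i' j' where "i' = fst (\<pi> (i, j))" and "j' = snd (\<pi> (i, j))"
  have i'j': "i' = i \<and> j' = j \<or> i' = j \<and> j' = i"
    using offdiag_matching(1)[OF ij] by (auto simp: i'_def j'_def)
  obtain \<rho> where \<rho>: "E a i j = E' (\<rho> a) i' j'" for a
    using offdiag_matching(2)[OF ij] unfolding i'_def j'_def by metis
  have "inj \<rho>"
    by (rule injI) (metis A.E_eq_iff \<rho> ij(1,2))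
  have \<rho>_cases: "\<rho> = id \<or> \<rho> = swap_letter" using inj_letter_cases[OF \<open>inj \<rho>\<close>] .
  have li: "loop_lab i = id \<or> loop_lab i = swap_letter" and lj: "loop_lab j = id \<or> loop_lab j = swap_letter"
    using inj_letter_cases inj_loop_lab ij by blast+
  have lk: "loop_lab l (loop_lab l a) = a" if "l = i \<or> l = j" for l a
    using li lj that by (metis eq_id_iff swap_letter_simps(3))
  have loop': "E' a l l = E (loop_lab l a) l l" if "l = i \<or> l = j" for l a
    using loop_lab[of l "loop_lab l a"] lk[OF that] that ij by auto
  have key: "(\<Sum>a\<in>UNIV. fox_deriv n c a g h * (g a - h a))
           = (\<Sum>a\<in>UNIV. fox_deriv n c a g h * (g (loop_lab i (\<rho> a)) - h (loop_lab j (\<rho> a))))" for g h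
  proof -
    let ?G = "\<lambda>l. if l = i then g else h"
    let ?z = "A.diag_val ?G"
    have z: "A.diagonal ?z" "B.diagonal ?z" by (simp_all add: diagonal_iff[symmetric])
    have lvi: "B.loop_vals ?z i = (\<lambda>a. g (loop_lab i a))"
      and lvj: "B.loop_vals ?z j = (\<lambda>a. h (loop_lab j a))"
      using ij by (simp_all add: fun_eq_iff B.loop_vals_def loop' A.diag_val_def)
    have D: "fox_deriv n c a g h = fox_deriv n c' (\<rho> a) (B.loop_vals ?z i') (B.loop_vals ?z j')" for a
    proof -
      have "fox_deriv n c a g h = A.ev n c (?z(E a i j := 1)) i j"
        using ij by (simp add: A.ev_one)
      also have "\<dots> = B.ev n c' (?z(E' (\<rho> a) i' j' := 1)) i' j'"
        using ij by (simp add: ev_eq \<rho> i'_def j'_def)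
      also have "\<dots> = fox_deriv n c' (\<rho> a) (B.loop_vals ?z i') (B.loop_vals ?z j')"
        by (rule B.ev_one) (use z ij i'j' in auto)
      finally show ?thesis .
    qed
    have F: "comm_part n c (?G l) = comm_part n c' (B.loop_vals ?z l)" if "l < k" for l
    proof -
      have "comm_part n c (?G l) = A.ev n c ?z l l" using that by (simp add: A.ev_diag)
      also have "\<dots> = B.ev n c' ?z l l" using that by (simp add: ev_eq pi_diag)
      also have "\<dots> = comm_part n c' (B.loop_vals ?z l)" using that z by (simp add: B.ev_diag)
      finally show ?thesis .
    qed
    have "(\<Sum>a\<in>UNIV. fox_deriv n c a g h * (B.loop_vals ?z i' (\<rho> a) - B.loop_vals ?z j' (\<rho> a)))
        = (\<Sum>a\<in>UNIV. fox_deriv n c' (\<rho> a) (B.loop_vals ?z i') (B.loop_vals ?z j') * (B.loop_vals ?z i' (\<rho> a) - B.loop_vals ?z j' (\<rho> a)))"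
      by (simp add: D)
    also have "\<dots> = (\<Sum>b\<in>UNIV. fox_deriv n c' b (B.loop_vals ?z i') (B.loop_vals ?z j') * (B.loop_vals ?z i' b - B.loop_vals ?z j' b))"
      using \<rho>_cases by (auto simp: sum_letter)
    also have "\<dots> = comm_part n c (?G i') - comm_part n c (?G j')"
      unfolding fox_deriv_telescope using F[of i'] F[of j'] i'j' ij by auto
    finally have eq: "(\<Sum>a\<in>UNIV. fox_deriv n c a g h * (B.loop_vals ?z i' (\<rho> a) - B.loop_vals ?z j' (\<rho> a)))
      = comm_part n c (?G i') - comm_part n c (?G j')" .
    have eq': "(\<Sum>a\<in>UNIV. fox_deriv n c a g h * (g a - h a)) = comm_part n c g - comm_part n c h"
      by (rule fox_deriv_telescope)
    \<comment> \<open>If \<open>\<pi>\<close> reverses the edge, both sides of \<open>eq\<close>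
      change sign.\<close>
    show ?thesis
      using i'j' eq eq' ij by (auto simp: lvi lvj sum_letter algebra_simps)
  qed
  have "\<rho> = loop_lab i \<and> \<rho> = loop_lab j"
  proof (rule ccontr)
    assume neg: "\<not> (\<rho> = loop_lab i \<and> \<rho> = loop_lab j)"
    \<comment> \<open>\<open>\<mu>\<close> and \<open>\<nu>\<close> measure how the colour change of
      the edge differs from that of the loops at its two ends.\<close>
    define \<mu> \<nu> where "\<mu> = loop_lab i \<circ> \<rho>" and "\<nu> = loop_lab j \<circ> \<rho>"
    have key': "(\<Sum>a\<in>UNIV. fox_deriv n c a g h * (g a - h a)) = (\<Sum>a\<in>UNIV. fox_deriv n c a g h * (g (\<mu> a) - h (\<nu> a)))" for g h
      using key by (simp add: \<mu>_def \<nu>_def)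
    have offoff: "swap_letter \<circ> swap_letter = id" "swap_letter \<noteq> id" by (auto simp: fun_eq_iff)
    consider "\<mu> = swap_letter" "\<nu> = id" | "\<mu> = id" "\<nu> = swap_letter" | "\<mu> = swap_letter" "\<nu> = swap_letter"
      using neg \<rho>_cases li lj by (auto simp: \<mu>_def \<nu>_def offoff)
    then show False
    proof cases
      case 1
      have diff: "(fox_deriv n c LX g h - fox_deriv n c LY g h) * (g LX - g LY) = 0" for g h
        using key'[of g h] by (simp add: 1 sum_letter algebra_simps)
      have D: "fox_deriv n c LX g h = fox_deriv n c LY g h" if "g LX \<noteq> g LY" for g h
        using that diff[of g h] by simp
      show False
      proof (rule not_sum_invariant[where P = "\<lambda>g h. g LX \<noteq> g LY"])
        fix g h :: "letter \<Rightarrow> real"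
        assume "g LX + g LY = h LX + h LY"
        then show "\<exists>m. m LX + m LY = g LX + g LY \<and> g LX \<noteq> g LY \<and> h LX \<noteq> h LY
           \<or> m LX + m LY = g LX + g LY \<and> m LX \<noteq> m LY \<and> m LX \<noteq> m LY"
          \<comment> \<open>Half the common sum, shifted by 1 and -1, keeps the sum and gives
            distinct coordinates.\<close>
          by (intro exI[of _ "case_letter ((g LX + g LY) / 2 + 1) ((g LX + g LY) / 2 - 1)"]) simp
      qed (use D in blast)
    next
      case 2
      have diff: "(fox_deriv n c LX g h - fox_deriv n c LY g h) * (h LX - h LY) = 0" for g h
        using key'[of g h] by (simp add: 2 sum_letter algebra_simps)
      have D: "fox_deriv n c LX g h = fox_deriv n c LY g h" if "h LX \<noteq> h LY" for g h
        using that diff[of g h] by simp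
      show False
      proof (rule not_sum_invariant[where P = "\<lambda>g h. h LX \<noteq> h LY"])
        fix g h :: "letter \<Rightarrow> real"
        assume "g LX + g LY = h LX + h LY"
        then show "\<exists>m. m LX + m LY = g LX + g LY \<and> m LX \<noteq> m LY \<and> m LX \<noteq> m LY
           \<or> m LX + m LY = g LX + g LY \<and> g LX \<noteq> g LY \<and> h LX \<noteq> h LY"
          by (intro exI[of _ "case_letter ((g LX + g LY) / 2 + 1) ((g LX + g LY) / 2 - 1)"]) simp
      qed (use D in blast)
    next
      case 3
      have diff: "(fox_deriv n c LX g h - fox_deriv n c LY g h) * (g LX - g LY - h LX + h LY) = 0" for g h
        using key'[of g h] by (simp add: 3 sum_letter algebra_simps)
      have D: "fox_deriv n c LX g h = fox_deriv n c LY g h" if "g LX - g LY - h LX + h LY \<noteq> 0" for g h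
        using that diff[of g h] by simp
      show False
      proof (rule not_sum_invariant[where P = "\<lambda>g h. g LX - g LY - h LX + h LY \<noteq> 0"])
        fix g h :: "letter \<Rightarrow> real"
        assume "g LX + g LY = h LX + h LY"
        then show "\<exists>m. m LX + m LY = g LX + g LY \<and> g LX - g LY - m LX + m LY \<noteq> 0 \<and> h LX - h LY - m LX + m LY \<noteq> 0
           \<or> m LX + m LY = g LX + g LY \<and> m LX - m LY - g LX + g LY \<noteq> 0 \<and> m LX - m LY - h LX + h LY \<noteq> 0"
          \<comment> \<open>With equal sums the condition says only that \<open>m LX\<close> differs
            from \<open>g LX\<close> and \<open>h LX\<close>; a number larger than both will
            do.\<close>
          by (intro exI[of _ "case_letter (\<bar>g LX\<bar> + \<bar>h LX\<bar> + 1) (g LX + g LY - (\<bar>g LX\<bar> + \<bar>h LX\<bar> + 1))"]) (simp, linarith)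
      qed (use D in blast)
    qed
  qed
  moreover have "b = \<rho> a"
  proof -
    have "E' b i' j' = E' (\<rho> a) i' j'" using b \<rho>[of a] by (simp add: i'_def j'_def)
    then show ?thesis using i'j' ij by auto
  qed
  ultimately show "b = loop_lab i a" "b = loop_lab j a" by auto
qed

text \<open>In the first grid the two edges compose; in the second both would end at
  \<open>j\<close>, so the mixed coefficient vanishes. Then \<open>fox_deriv2\<close> is zero and
  the first derivative cannot depend on its second argument.\<close>

lemma no_conflict:
  assumes "i < k" "j < k" "m < k" "i \<noteq> j" "j \<noteq> m" "i \<noteq> m"
  shows "\<not> (\<pi> (i, j) = (i, j) \<and> \<pi> (j, m) = (m, j))"
proof
  assume *: "\<pi> (i, j) = (i, j) \<and> \<pi> (j, m) = (m, j)"
  obtain a g h h' where ne: "fox_deriv n c a g h \<noteq> fox_deriv n c a g h'"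
    using fox_deriv_depends_snd by blast
  have "fox_deriv2 n c a b g h h' = 0" for b
  proof -
    let ?z = "A.diag_val (\<lambda>l. if l = i then g else if l = j then h else h')"
    obtain a' where a': "E a i j = E' a' i j" using offdiag_matching(2)[of i j a] assms * by auto
    obtain b' where b': "E b j m = E' b' m j" using offdiag_matching(2)[of j m b] assms * by auto
    have "fox_deriv2 n c a b g h h' = A.ev n c (?z(E a i j := 1, E b j m := 1)) i m"
      using assms by (simp add: A.ev_two)
    also have "\<dots> = B.ev n c' (?z(E' a' i j := 1, E' b' m j := 1)) (fst (\<pi> (i, m))) (snd (\<pi> (i, m)))"
      using assms by (simp add: ev_eq a' b')
    also have "\<dots> = 0"
      by (rule B.ev_two_anti) (use assms offdiag_matching(1)[of i m] in \<open>auto simp: diagonal_iff[symmetric]\<close>)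
    finally show ?thesis .
  qed
  then show False using fox_deriv2_telescope[of n c a g h h'] ne by simp
qed

lemma pi_symmetric:
  assumes "i < k" "j < k" "i \<noteq> j" "\<pi> (i, j) = (i, j)"
  shows "\<pi> (j, i) = (j, i)"
proof (rule ccontr)
  assume "\<pi> (j, i) \<noteq> (j, i)"
  then have "\<pi> (j, i) = \<pi> (i, j)" using offdiag_matching(1)[of j i] assms by auto
  then have "(j, i) = (i, j)"
    using bij_betw_imp_inj_on[OF pi_bij] assms unfolding inj_on_def by blast
  then show False using assms by simp
qed

text \<open>A fixed edge fixes all edges out of its head, so from one fixed edge
  \<open>(p, q)\<close> two steps, to \<open>(q, i)\<close> and then to \<open>(i, j)\<close>, reach
  every pair.\<close>

lemma pi_uniform: "(\<forall>i<k. \<forall>j<k. \<pi> (i, j) = (i, j)) \<or> (\<forall>i<k. \<forall>j<k. \<pi> (i, j) = (j, i))"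
proof (cases "\<exists>i<k. \<exists>j<k. i \<noteq> j \<and> \<pi> (i, j) = (i, j)")
  case False
  then have "\<pi> (i, j) = (j, i)" if "i < k" "j < k" for i j
    using that offdiag_matching(1)[of i j] pi_diag by (cases "i = j") auto
  then show ?thesis by blast
next
  case True
  then obtain p q where pq: "p < k" "q < k" "p \<noteq> q" "\<pi> (p, q) = (p, q)" by blast
  have next_edge: "\<pi> (j, m) = (j, m)" if "\<pi> (i, j) = (i, j)" "i < k" "j < k" "m < k" "i \<noteq> j" for i j m
  proof -
    consider "j = m" | "i = m" | "j \<noteq> m" "i \<noteq> m" by blast
    then show ?thesis
    proof cases
      case 1
      then show ?thesis using that pi_diag by simp
    next
      case 2
      then show ?thesis using that pi_symmetric[of i j] by simp
    next
      case 3
      then show ?thesis using no_conflict[of i j m] offdiag_matching(1)[of j m] that by auto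
    qed
  qed
  have "\<pi> (i, j) = (i, j)" if "i < k" "j < k" for i j
  proof -
    have q: "\<pi> (q, i) = (q, i)" using next_edge[OF pq(4,1,2) that(1) pq(3)] .
    show ?thesis
    proof (cases "q = i")
      case True
      then show ?thesis using next_edge[OF pq(4,1,2) that(2) pq(3)] by simp
    next
      case False
      then show ?thesis using next_edge[OF q pq(2) that] by simp
    qed
  qed
  then show ?thesis by blast
qed

text \<open>\<open>orientation\<close> ties the colour changes at the two ends of an edge together;
  comparing every vertex with vertex 0 makes the change global.\<close>

theorem rigidity:
  assumes "k \<ge> 1"
  shows "\<exists>\<omega>. (\<omega> = id \<or> \<omega> = swap_letter) \<and>
    ((\<forall>a. \<forall>i<k. \<forall>j<k. E a i j = E' (\<omega> a) i j) \<or> (\<forall>a. \<forall>i<k. \<forall>j<k. E a i j = E' (\<omega> a) j i))"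
proof -
  let ?\<omega> = "loop_lab 0"
  have all: "loop_lab i = ?\<omega>" if i: "i < k" for i
  proof (cases "i = 0")
    case False
    show ?thesis
    proof
      fix a
      have i0: "i < k" "0 < k" "i \<noteq> 0" using False i assms by auto
      obtain b where b: "E a i 0 = E' b (fst (\<pi> (i, 0))) (snd (\<pi> (i, 0)))"
        using offdiag_matching(2)[OF i0] by blast
      show "loop_lab i a = loop_lab 0 a"
        using orientation(2)[OF i0 b] unfolding orientation(1)[OF i0 b] .
    qed
  qed simp
  have E: "E a i j = E' (?\<omega> a) (fst (\<pi> (i, j))) (snd (\<pi> (i, j)))" if ij: "i < k" "j < k" for a i j
  proof (cases "i = j")
    case True
    have "E a i i = E' (?\<omega> a) i i" using loop_lab[OF ij(1), of a] unfolding all[OF ij(1)] .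
    with True ij show ?thesis by (simp only: pi_diag fst_conv snd_conv)
  next
    case False
    then obtain b where b: "E a i j = E' b (fst (\<pi> (i, j))) (snd (\<pi> (i, j)))"
      using offdiag_matching(2)[OF ij] by blast
    have "b = ?\<omega> a" using orientation(1)[OF ij False b] unfolding all[OF ij(1)] .
    with b show ?thesis by (simp only:)
  qed
  have "?\<omega> = id \<or> ?\<omega> = swap_letter" using inj_letter_cases inj_loop_lab assms by simp
  moreover have "(\<forall>a. \<forall>i<k. \<forall>j<k. E a i j = E' (?\<omega> a) i j) \<or> (\<forall>a. \<forall>i<k. \<forall>j<k. E a i j = E' (?\<omega> a) j i)"
    using pi_uniform
  proof
    assume *: "\<forall>i<k. \<forall>j<k. \<pi> (i, j) = (i, j)"
    have "\<forall>a. \<forall>i<k. \<forall>j<k. E a i j = E' (?\<omega> a) i j"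
    proof (intro allI impI)
      fix a i j assume ij: "i < k" "j < k"
      with * have "\<pi> (i, j) = (i, j)" by blast
      then show "E a i j = E' (?\<omega> a) i j" using E[OF ij, of a] by (simp only: fst_conv snd_conv)
    qed
    then show ?thesis ..
  next
    assume *: "\<forall>i<k. \<forall>j<k. \<pi> (i, j) = (j, i)"
    have "\<forall>a. \<forall>i<k. \<forall>j<k. E a i j = E' (?\<omega> a) j i"
    proof (intro allI impI)
      fix a i j assume ij: "i < k" "j < k"
      with * have "\<pi> (i, j) = (j, i)" by blast
      then show "E a i j = E' (?\<omega> a) j i" using E[OF ij, of a] by (simp only: fst_conv snd_conv)
    qed
    then show ?thesis ..
  qed
  ultimately show ?thesis by blast
qed

end

section \<open>Coefficients of special monomials\<close>

primrec alt :: "'a \<Rightarrow> 'a \<Rightarrow> nat \<Rightarrow> 'a list" where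
  "alt x y 0 = []"
| "alt x y (Suc n) = x # alt y x n"

lemma length_alt [simp]: "length (alt x y n) = n"
  by (induction n arbitrary: x y) auto

lemma map_alt: "map f (alt x y n) = alt (f x) (f y) n"
  by (induction n arbitrary: x y) auto

lemma alt_odd: "alt x y (Suc (2 * t)) = concat (replicate t [x, y]) @ [x]"
  by (induction t) auto

lemma mset_alt_odd: "mset (alt x y (Suc (2 * t))) = replicate_mset (Suc t) x + replicate_mset t y"
  by (induction t) auto

definition type_sum :: "(letter list \<Rightarrow> real) \<Rightarrow> nat \<Rightarrow> nat \<Rightarrow> real" where
  "type_sum c s t = (\<Sum>w\<in>words_of_type s t. c w)"

lemma cnt_simps [simp]: "cnt a [] = 0" "cnt a (b # w) = (if b = a then Suc (cnt a w) else cnt a w)"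
  by (simp_all add: cnt_def)

lemma cnt_append [simp]: "cnt a (w @ w') = cnt a w + cnt a w'"
  by (simp add: cnt_def)

lemma cnt_add_length: "cnt LX w + cnt LY w = length w"
proof (induction w)
  case (Cons a w)
  then show ?case by (cases a) auto
qed simp

lemma words_of_type_subset: "words_of_type s t \<subseteq> words (s + t)"
  by (auto simp: words_of_type_def words_def cnt_add_length[symmetric])

lemma finite_words_of_type [simp]: "finite (words_of_type s t)"
  by (rule finite_subset[OF words_of_type_subset]) simp

context grid
begin

text \<open>Kirchhoff's balance of an edge at \<open>v\<close>: in minus out, so a loop counts
  0.\<close>

definition div_at :: "nat \<Rightarrow> nat \<Rightarrow> int" where
  "div_at v x = of_bool (tgt x = v) - of_bool (src x = v)"

lemma div_at_cases: "div_at v x = -1 \<or> div_at v x = 0 \<or> div_at v x = 1"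
  by (simp add: div_at_def)

text \<open>The balances telescope along the walk, yet their sum depends on the multiset alone: this
  constrains all walks with a given monomial at once.\<close>

lemma walk_divergence:
  assumes "walk i xs j"
  shows "(\<Sum>x\<in>#mset xs. div_at v x) = of_bool (j = v) - of_bool (i = v)"
  using assms by (induction xs arbitrary: i) (auto simp: div_at_def)

lemma walk_loops:
  assumes "walk i xs j" "\<forall>x\<in>set xs. src x = tgt x"
  shows "j = i \<and> (\<forall>x\<in>set xs. src x = i)"
  using assms by (induction xs arbitrary: i) auto

text \<open>For a non-loop \<open>e\<close> the divergence of the walk at both ends of \<open>e\<close> forces \<open>f\<close> to run backwards.\<close>

lemma walk_two_edges:
  assumes w: "walk i xs j" and M: "mset xs = replicate_mset s e + replicate_mset t f"
    and st: "s \<ge> 2" "t \<ge> 2"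
  shows "(src e = i \<and> tgt e = i \<and> src f = i \<and> tgt f = i \<and> j = i) \<or>
    (src e \<noteq> tgt e \<and> src f = tgt e \<and> tgt f = src e \<and>
      (s = t \<and> i = j \<or> s = Suc t \<and> i = src e \<and> j = tgt e \<or> t = Suc s \<and> i = src f \<and> j = tgt f))"
proof -
  have D: "int s * div_at v e + int t * div_at v f = of_bool (j = v) - of_bool (i = v)" for v
    using walk_divergence[OF w, of v] by (simp add: M)
  have b: "\<bar>of_bool (j = v) - of_bool (i = v) :: int\<bar> \<le> 1" for v by auto
  show ?thesis
  proof (cases "src e = tgt e")
    case True
    then have "div_at v e = 0" for v by (simp add: div_at_def)
    then have Df: "\<bar>int t * div_at v f\<bar> \<le> 1" for v using D[of v] b[of v] by simp
    have f: "src f = tgt f"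
    proof (rule ccontr)
      assume "src f \<noteq> tgt f"
      then have "div_at (tgt f) f = 1" by (simp add: div_at_def)
      then show False using Df[of "tgt f"] st by simp
    qed
    have "set xs = {e, f}"
      using mset_eq_setD[of xs "replicate s e @ replicate t f"] M st by auto
    then show ?thesis using walk_loops[OF w] True f by auto
  next
    case False
    then have e: "div_at (tgt e) e = 1" "div_at (src e) e = -1" by (auto simp: div_at_def)
    have "int s + int t * div_at (tgt e) f \<le> 1" using D[of "tgt e"] b[of "tgt e"] e by simp
    then have "div_at (tgt e) f < 0"
      using st div_at_cases[of "tgt e" f] by auto
    then have f1: "src f = tgt e" by (auto simp: div_at_def split: if_splits)
    have "- int s + int t * div_at (src e) f \<ge> -1" using D[of "src e"] b[of "src e"] e by simp
    then have "div_at (src e) f > 0"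
      using st div_at_cases[of "src e" f] by auto
    then have f2: "tgt f = src e" by (auto simp: div_at_def split: if_splits)
    \<comment> \<open>Opposite edges cancel, so the surplus \<open>s - t\<close> is the only flow
      left between the ends.\<close>
    have D': "(int s - int t) * div_at v e = of_bool (j = v) - of_bool (i = v)" for v
      using D[of v] f1 f2 by (simp add: div_at_def algebra_simps)
    have d1: "int s - int t = of_bool (j = tgt e) - of_bool (i = tgt e)"
      and d2: "int t - int s = of_bool (j = src e) - of_bool (i = src e)"
      using D'[of "tgt e"] D'[of "src e"] e by auto
    have "\<bar>int s - int t\<bar> \<le> 1" unfolding d1 by (rule b)
    then consider "s = t" | "int s - int t = 1" | "int t - int s = 1"
      by linarith
    then show ?thesis
    proof cases
      case 1
      then have "i = j" using D'[of i] by (cases "i = j") auto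
      with 1 False f1 f2 show ?thesis by simp
    next
      case 2
      then have "s = Suc t" "j = tgt e" "i = src e" using d1 d2 by (auto simp: of_bool_def split: if_splits)
      with False f1 f2 show ?thesis by simp
    next
      case 3
      then have "t = Suc s" "i = tgt e" "j = src e" using d1 d2 by (auto simp: of_bool_def split: if_splits)
      with False f1 f2 show ?thesis by simp
    qed
  qed
qed

lemma coef_nonzero_walk:
  assumes "coef c M i j \<noteq> 0"
  obtains xs where "mset xs = M" "walk i xs j"
proof -
  have "{xs \<in> permutations_of_multiset M. walk i xs j} \<noteq> {}"
    using assms unfolding coef_def by (metis (no_types, lifting) sum.empty)
  then show thesis using that by (auto simp: permutations_of_multiset_def)
qed

lemma mset_loops:
  "mset (map (\<lambda>a. E a i i) w) = replicate_mset (cnt LX w) (E LX i i) + replicate_mset (cnt LY w) (E LY i i)"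
proof (induction w)
  case (Cons a w)
  then show ?case by (cases a) auto
qed simp

lemma loops_map_lab:
  assumes "i < k" "set xs \<subseteq> {E LX i i, E LY i i}"
  shows "map (\<lambda>a. E a i i) (map lab xs) = xs"
  using assms(2) by (induction xs) (use assms(1) in auto)

lemma walk_loops_at:
  assumes "i < k" "set xs \<subseteq> {E LX i i, E LY i i}"
  shows "walk i xs i"
  using assms(2) by (induction xs) (use assms(1) in auto)

lemma set_loop_perm:
  assumes "xs \<in> permutations_of_multiset (replicate_mset s u + replicate_mset t v)"
  shows "set xs \<subseteq> {u, v}"
proof -
  have "set xs = set_mset (replicate_mset s u + replicate_mset t v)"
    using assms by (auto simp: permutations_of_multiset_def dest: arg_cong[where f = set_mset])
  then show ?thesis by (auto split: if_splits)
qed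

lemma sum_loops:
  assumes i: "i < k"
  shows "(\<Sum>xs\<in>permutations_of_multiset (replicate_mset s (E LX i i) + replicate_mset t (E LY i i)). g (map lab xs))
       = (\<Sum>w\<in>words_of_type s t. g w)"
proof (rule sum.reindex_bij_witness[where i = "map (\<lambda>a. E a i i)" and j = "map lab"])
  fix xs
  assume xs: "xs \<in> permutations_of_multiset (replicate_mset s (E LX i i) + replicate_mset t (E LY i i))"
  show inv: "map (\<lambda>a. E a i i) (map lab xs) = xs"
    by (rule loops_map_lab[OF i set_loop_perm[OF xs]])
  have eq: "replicate_mset (cnt LX (map lab xs)) (E LX i i) + replicate_mset (cnt LY (map lab xs)) (E LY i i)
      = replicate_mset s (E LX i i) + replicate_mset t (E LY i i)"
    using xs unfolding mset_loops[symmetric] inv by (simp add: permutations_of_multiset_def)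
  have "cnt LX (map lab xs) = s" "cnt LY (map lab xs) = t"
    using arg_cong[OF eq, of "\<lambda>M. count M (E LX i i)"] arg_cong[OF eq, of "\<lambda>M. count M (E LY i i)"] i
    by auto
  then show "map lab xs \<in> words_of_type s t" by (simp add: words_of_type_def)
next
  fix w assume w: "w \<in> words_of_type s t"
  have "map (\<lambda>a. lab (E a i i)) w = w" using i by (simp add: map_idI)
  then show "map lab (map (\<lambda>a. E a i i) w) = w" by (simp add: comp_def)
  show "map (\<lambda>a. E a i i) w \<in> permutations_of_multiset (replicate_mset s (E LX i i) + replicate_mset t (E LY i i))"
    using w mset_loops[of i w] by (simp add: words_of_type_def permutations_of_multiset_def)
qed simp

text \<open>All orderings of loops at one vertex are walks, so every word of the given type
  contributes.\<close>

lemma coef_loops: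
  assumes "i < k"
  shows "coef c (replicate_mset s (E LX i i) + replicate_mset t (E LY i i)) i i = type_sum c s t"
proof -
  let ?P = "permutations_of_multiset (replicate_mset s (E LX i i) + replicate_mset t (E LY i i))"
  have "{xs \<in> ?P. walk i xs i} = ?P"
    using walk_loops_at[OF assms set_loop_perm] by blast
  then show ?thesis
    unfolding coef_def type_sum_def using sum_loops[OF assms, of c s t] by simp
qed

lemma walk_exit:
  assumes "walk i xs m" "i \<noteq> m" "i < k" "m < k" "set xs \<subseteq> {E LX i i, E LY i i, E a i m}"
  shows "\<exists>ys. xs = ys @ [E a i m]"
  using assms(1,5)
proof (induction xs)
  case Nil
  then show ?case using assms(2) by simp
next
  case (Cons x xs)
  show ?case
  proof (cases "x = E a i m")
    case True
    then have "walk m xs m" using Cons.prems assms by simp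
    moreover have "xs = []"
    proof (cases xs)
      case (Cons y ys)
      then have "src y = i" using Cons.prems assms by auto
      then show ?thesis using \<open>walk m xs m\<close> Cons assms(2) by simp
    qed simp
    ultimately show ?thesis using True by auto
  next
    case False
    then have "x \<in> {E LX i i, E LY i i}" using Cons.prems by auto
    then have "tgt x = i" using assms(3) by auto
    then obtain ys where "xs = ys @ [E a i m]" using Cons by auto
    then show ?thesis by (intro exI[of _ "x # ys"]) simp
  qed
qed

text \<open>The edge to \<open>m\<close> can only be the last step, since nothing in the multiset
  leaves \<open>m\<close>. This makes the sums over words with a prescribed last letter, as in list
  3, visible in an off-diagonal entry.\<close>

lemma coef_exit:
  assumes "i < k" "m < k" "i \<noteq> m"
  shows "coef c (add_mset (E a i m) (replicate_mset s (E LX i i) + replicate_mset t (E LY i i))) i m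
       = (\<Sum>w\<in>words_of_type s t. c (w @ [a]))"
proof -
  let ?M = "replicate_mset s (E LX i i) + replicate_mset t (E LY i i)" and ?x = "E a i m"
  have eq: "{xs \<in> permutations_of_multiset (add_mset ?x ?M). walk i xs m}
      = (\<lambda>ys. ys @ [?x]) ` permutations_of_multiset ?M"
  proof (intro equalityI subsetI)
    fix xs assume "xs \<in> {xs \<in> permutations_of_multiset (add_mset ?x ?M). walk i xs m}"
    then have M: "mset xs = add_mset ?x ?M" and w: "walk i xs m"
      by (auto simp: permutations_of_multiset_def)
    have "set xs = set_mset (add_mset ?x ?M)" using M by (metis set_mset_mset)
    then have "set xs \<subseteq> {E LX i i, E LY i i, E a i m}" by (auto split: if_splits)
    then obtain ys where "xs = ys @ [?x]" using walk_exit[OF w assms(3,1,2)] by blast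
    with M show "xs \<in> (\<lambda>ys. ys @ [?x]) ` permutations_of_multiset ?M"
      by (auto simp: permutations_of_multiset_def)
  next
    fix xs assume "xs \<in> (\<lambda>ys. ys @ [?x]) ` permutations_of_multiset ?M"
    then obtain ys where ys: "ys \<in> permutations_of_multiset ?M" "xs = ys @ [?x]" by blast
    have "walk i ys i" using walk_loops_at[OF assms(1) set_loop_perm[OF ys(1)]] .
    with ys assms show "xs \<in> {xs \<in> permutations_of_multiset (add_mset ?x ?M). walk i xs m}"
      by (auto simp: walk_append permutations_of_multiset_def)
  qed
  have "coef c (add_mset ?x ?M) i m = (\<Sum>ys\<in>permutations_of_multiset ?M. c (map lab ys @ [a]))"
    unfolding coef_def eq using assms by (subst sum.reindex) (auto simp: inj_on_def)
  also have "\<dots> = (\<Sum>w\<in>words_of_type s t. c (w @ [a]))"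
    by (rule sum_loops[OF assms(1), of "\<lambda>w. c (w @ [a])"])
  finally show ?thesis .
qed

lemma walk_opposite:
  assumes "walk (src e) xs j" "set xs \<subseteq> {e, f}" "tgt e = src f" "tgt f = src e" "src e \<noteq> tgt e"
  shows "xs = alt e f (length xs)"
  using assms
proof (induction xs arbitrary: e f)
  case (Cons x xs)
  then have "x = e" by auto
  moreover have "xs = alt f e (length xs)"
    by (rule Cons.IH) (use Cons.prems \<open>x = e\<close> in auto)
  ultimately show ?case by simp
qed simp

lemma walk_alt:
  assumes "tgt e = src f" "tgt f = src e"
  shows "walk (src e) (alt e f (Suc (2 * t))) (tgt e)"
  using assms by (induction t) auto

text \<open>Along two opposite edges there is no choice: the walk alternates, and the extra copy of
  \<open>e\<close> makes it start and end with \<open>e\<close>.\<close>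

lemma coef_opposite:
  assumes "tgt e = src f" "tgt f = src e" "src e \<noteq> tgt e"
  shows "coef c (replicate_mset (Suc t) e + replicate_mset t f) (src e) (tgt e)
       = c (alt (lab e) (lab f) (Suc (2 * t)))"
proof -
  let ?M = "replicate_mset (Suc t) e + replicate_mset t f"
  have "{xs \<in> permutations_of_multiset ?M. walk (src e) xs (tgt e)} = {alt e f (Suc (2 * t))}"
  proof (intro equalityI subsetI)
    fix xs assume "xs \<in> {xs \<in> permutations_of_multiset ?M. walk (src e) xs (tgt e)}"
    then have xs: "xs \<in> permutations_of_multiset ?M" and w: "walk (src e) xs (tgt e)" by auto
    have "length xs = Suc (2 * t)"
      using xs by (auto simp: permutations_of_multiset_def dest: arg_cong[where f = size])
    then show "xs \<in> {alt e f (Suc (2 * t))}"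
      using walk_opposite[OF w set_loop_perm[OF xs] assms] by simp
  next
    fix xs assume "xs \<in> {alt e f (Suc (2 * t))}"
    then have "xs = alt e f (Suc (2 * t))" by simp
    then show "xs \<in> {xs \<in> permutations_of_multiset ?M. walk (src e) xs (tgt e)}"
      using walk_alt[OF assms(1,2), of t] mset_alt_odd[of e f t]
      by (simp only: permutations_of_multiset_def mem_Collect_eq simp_thms)
  qed
  then show ?thesis by (simp add: coef_def map_alt del: alt.simps replicate_mset_Suc)
qed

end

section \<open>Comparing the loops of the two representations\<close>

locale two_reps = A: grid k V E + B: grid k V E'
  for k :: nat and V :: "nat set" and E E' :: "letter \<Rightarrow> nat \<Rightarrow> nat \<Rightarrow> nat" +
  fixes c c' :: "letter list \<Rightarrow> real" and \<pi> :: "nat \<times> nat \<Rightarrow> nat \<times> nat"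
  assumes pi_bij: "bij_betw \<pi> ({..<k} \<times> {..<k}) ({..<k} \<times> {..<k})"
    and coef_eq: "i < k \<Longrightarrow> j < k \<Longrightarrow> set_mset M \<subseteq> V \<Longrightarrow>
      A.coef c M i j = B.coef c' M (fst (\<pi> (i, j))) (snd (\<pi> (i, j)))"
begin

lemma pi_less:
  assumes "i < k" "j < k"
  shows "fst (\<pi> (i, j)) < k" "snd (\<pi> (i, j)) < k"
proof -
  have "\<pi> (i, j) \<in> {..<k} \<times> {..<k}" using bij_betwE[OF pi_bij] assms by blast
  then show "fst (\<pi> (i, j)) < k" "snd (\<pi> (i, j)) < k" by (simp_all add: mem_Times_iff)
qed

lemma ev_eq:
  assumes "i < k" "j < k"
  shows "A.ev n c z i j = B.ev n c' z (fst (\<pi> (i, j))) (snd (\<pi> (i, j)))"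
  unfolding A.ev_coef[OF assms] B.ev_coef[OF pi_less[OF assms]]
  by (intro sum.cong refl, subst coef_eq) (use assms in auto)

definition matches :: "nat \<Rightarrow> nat \<Rightarrow> bool" where
  "matches i j \<longleftrightarrow> j < k \<and> \<pi> (i, i) = (j, j) \<and> range (\<lambda>a. E a i i) = range (\<lambda>a. E' a j j)"

lemma loop_edges:
  assumes "i < k" "j < k" "\<And>a. B.src (E a i i) = j" "\<And>a. B.tgt (E a i i) = j"
  shows "range (\<lambda>a. E a i i) = range (\<lambda>a. E' a j j)"
proof -
  have E: "E a i i = E' (B.lab (E a i i)) j j" for a
    using B.E_lab[of "E a i i"] assms by simp
  have "inj (\<lambda>a. B.lab (E a i i))"
    by (rule injI) (metis A.E_eq_iff E assms(1))
  then have "surj (\<lambda>a. B.lab (E a i i))" by (simp add: finite_UNIV_inj_surj)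
  moreover have "range (\<lambda>a. E a i i) = (\<lambda>a. E' a j j) ` range (\<lambda>a. B.lab (E a i i))"
    unfolding image_image using E by simp
  ultimately show ?thesis by simp
qed

text \<open>A nonzero coefficient must come from some walk in the second grid, and exponents of at
  least 2 leave only the two shapes of \<open>walk_two_edges\<close>.\<close>

lemma loop_monomial:
  assumes "i < k" "type_sum c s t \<noteq> 0" "s \<ge> 2" "t \<ge> 2"
  defines "j \<equiv> fst (\<pi> (i, i))" and "l \<equiv> snd (\<pi> (i, i))"
    and "e \<equiv> E LX i i" and "f \<equiv> E LY i i"
  shows "matches i j \<or>
    (B.src e \<noteq> B.tgt e \<and> B.src f = B.tgt e \<and> B.tgt f = B.src e \<and>
      (s = t \<and> j = l \<or> s = Suc t \<and> j = B.src e \<and> l = B.tgt e \<or> t = Suc s \<and> j = B.src f \<and> l = B.tgt f))"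
proof -
  let ?M = "replicate_mset s e + replicate_mset t f"
  have jl: "j < k" "l < k" using pi_less assms(1) by (auto simp: j_def l_def)
  have "B.coef c' ?M j l = A.coef c ?M i i"
    unfolding j_def l_def by (rule coef_eq[symmetric]) (use assms(1) in \<open>auto simp: e_def f_def split: if_splits\<close>)
  also have "\<dots> \<noteq> 0" using assms(1,2) by (simp add: e_def f_def A.coef_loops)
  finally obtain xs where "mset xs = ?M" "B.walk j xs l" by (rule B.coef_nonzero_walk)
  from B.walk_two_edges[OF this(2,1) assms(3,4)] show ?thesis
  proof
    assume *: "B.src e = j \<and> B.tgt e = j \<and> B.src f = j \<and> B.tgt f = j \<and> l = j"
    have "B.src (E a i i) = j" "B.tgt (E a i i) = j" for a
      using * by (cases a; simp add: e_def f_def)+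
    then have "range (\<lambda>a. E a i i) = range (\<lambda>a. E' a j j)"
      using loop_edges assms(1) jl by blast
    moreover have "\<pi> (i, i) = (j, j)" using * by (simp add: j_def l_def prod_eq_iff)
    ultimately show ?thesis using jl by (simp add: matches_def)
  qed (rule disjI2)
qed

text \<open>Opposite edges would need exponents that differ by at most 1.\<close>

lemma list1_matches:
  assumes "i < k" "type_sum c s t \<noteq> 0" "s \<ge> t + 2" "t \<ge> 2"
  shows "\<exists>j. matches i j"
  using loop_monomial[OF assms(1,2)] assms(3,4) by fastforce

text \<open>If the loops at \<open>i\<close> became opposite edges \<open>e\<close> and \<open>f\<close>, then the monomials $g\,e^{r-1}f^r$ and
  $h\,e^r f^{r-1}$, with \<open>g\<close> and \<open>h\<close> the edges from \<open>i\<close> to \<open>m\<close>, would occur in one off-diagonal entry, but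
  their divergences are incompatible.\<close>

lemma list3_matches:
  assumes i: "i < k" and r: "r \<ge> 2" and phi: "type_sum c r r \<noteq> 0"
    and endX: "(\<Sum>w\<in>words_of_type (r - 1) r. c (w @ [LX])) \<noteq> 0"
    and endY: "(\<Sum>w\<in>words_of_type r (r - 1). c (w @ [LY])) \<noteq> 0"
  shows "\<exists>j. matches i j"
proof (rule ccontr)
  assume neg: "\<nexists>j. matches i j"
  define e f where "e = E LX i i" and "f = E LY i i"
  have opp: "B.src e \<noteq> B.tgt e" "B.src f = B.tgt e" "B.tgt f = B.src e"
    using loop_monomial[OF i phi r r] neg by (auto simp: e_def f_def)
  \<comment> \<open>With equal exponents both alternatives of \<open>loop_monomial\<close> give a
    diagonal entry.\<close>
  have diag: "fst (\<pi> (l, l)) = snd (\<pi> (l, l))" if "l < k" for l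
    using loop_monomial[OF that phi r r]
  proof
    assume "matches l (fst (\<pi> (l, l)))"
    then show ?thesis unfolding matches_def by (metis snd_conv)
  qed auto
  have ef: "e \<in> V" "f \<in> V" using i by (simp_all add: e_def f_def)
  \<comment> \<open>\<open>e\<close> joins two different vertices of the second grid, so a vertex
    other than \<open>i\<close> exists.\<close>
  obtain m where m: "m < k" "m \<noteq> i"
    using opp(1) B.src_less[OF ef(1)] B.tgt_less[OF ef(1)] by metis
  define l l' where "l = fst (\<pi> (i, m))" and "l' = snd (\<pi> (i, m))"
  \<comment> \<open>\<open>\<pi>\<close> maps the finite diagonal into itself, hence onto itself;
    off-diagonal entries therefore stay off the diagonal.\<close>
  have D: "(\<lambda>x. (x, x)) ` {..<k} = \<pi> ` (\<lambda>x. (x, x)) ` {..<k}"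
  proof -
    have inj: "inj_on \<pi> ((\<lambda>x. (x, x)) ` {..<k})"
      by (rule inj_on_subset[OF bij_betw_imp_inj_on[OF pi_bij]]) auto
    show ?thesis
    proof (rule card_subset_eq[symmetric])
      show "\<pi> ` (\<lambda>x. (x, x)) ` {..<k} \<subseteq> (\<lambda>x. (x, x)) ` {..<k}"
      proof
        fix y assume "y \<in> \<pi> ` (\<lambda>x. (x, x)) ` {..<k}"
        then obtain x where x: "x < k" "y = \<pi> (x, x)" by auto
        then have "\<pi> (x, x) = (fst (\<pi> (x, x)), fst (\<pi> (x, x)))" "fst (\<pi> (x, x)) < k"
          using diag[of x] pi_less[of x x] by (simp_all add: prod_eq_iff)
        then show "y \<in> (\<lambda>x. (x, x)) ` {..<k}" unfolding x(2) by blast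
      qed
    qed (simp_all add: card_image[OF inj])
  qed
  have ll': "l \<noteq> l'"
  proof
    assume "l = l'"
    then have "\<pi> (i, m) \<in> (\<lambda>x. (x, x)) ` {..<k}"
      using pi_less[OF i m(1)] by (auto simp: l_def l'_def prod_eq_iff image_iff)
    then have "\<pi> (i, m) \<in> \<pi> ` (\<lambda>x. (x, x)) ` {..<k}" by (subst D[symmetric])
    then obtain x where x: "x < k" "\<pi> (i, m) = \<pi> (x, x)" by auto
    then have "(i, m) = (x, x)"
      using bij_betw_imp_inj_on[OF pi_bij] i m(1) unfolding inj_on_def by blast
    then show False using m by simp
  qed
  have walkD: "B.div_at v x + int s * B.div_at v e + int t * B.div_at v f = of_bool (l' = v) - of_bool (l = v)"
    if "A.coef c (add_mset x (replicate_mset s e + replicate_mset t f)) i m \<noteq> 0" "x \<in> V" for x s t v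
  proof -
    have "set_mset (add_mset x (replicate_mset s e + replicate_mset t f)) \<subseteq> V"
      using that ef by (auto split: if_splits)
    then have "B.coef c' (add_mset x (replicate_mset s e + replicate_mset t f)) l l' \<noteq> 0"
      using coef_eq[OF i m(1)] that by (simp add: l_def l'_def)
    then obtain xs where "mset xs = add_mset x (replicate_mset s e + replicate_mset t f)" "B.walk l xs l'"
      by (rule B.coef_nonzero_walk)
    from B.walk_divergence[OF this(2), of v] this(1) show ?thesis by (simp add: add_ac)
  qed
  define g h where "g = E LX i m" and "h = E LY i m"
  have gh: "g \<in> V" "h \<in> V" using i m by (simp_all add: g_def h_def)
  have fe: "B.div_at v f = - B.div_at v e" for v
    using opp by (simp add: B.div_at_def)
  \<comment> \<open>\<open>f\<close> cancels \<open>e\<close>, so the exponents \<open>r - 1\<close>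
    and \<open>r\<close> leave one negative copy of \<open>e\<close>; for \<open>h\<close> below it
    is a positive one.\<close>
  have G: "B.div_at v g - B.div_at v e = of_bool (l' = v) - of_bool (l = v)" for v
  proof -
    have "A.coef c (add_mset g (replicate_mset (r - 1) e + replicate_mset r f)) i m \<noteq> 0"
      unfolding e_def f_def g_def using A.coef_exit[of i m c LX "r - 1" r] i m endX by simp
    from walkD[OF this gh(1), of v] r show ?thesis by (simp add: fe algebra_simps of_nat_diff)
  qed
  have H: "B.div_at v h + B.div_at v e = of_bool (l' = v) - of_bool (l = v)" for v
  proof -
    have "A.coef c (add_mset h (replicate_mset r e + replicate_mset (r - 1) f)) i m \<noteq> 0"
      unfolding e_def f_def h_def using A.coef_exit[of i m c LY r "r - 1"] i m endY by simp
    from walkD[OF this gh(2), of v] r show ?thesis by (simp add: fe algebra_simps of_nat_diff)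
  qed
  have bnd: "\<bar>B.div_at v x\<bar> \<le> 1" for v x by (simp add: B.div_at_def)
  have e1: "B.div_at (B.tgt e) e = 1" "B.div_at (B.src e) e = -1"
    using opp(1) by (simp_all add: B.div_at_def)
  \<comment> \<open>At the head of \<open>e\<close> the left side of \<open>G\<close> is at most 0
    and that of \<open>H\<close> at least 0; both equal the same right side, which is then
    0.\<close>
  have t: "l \<noteq> B.tgt e" "l' \<noteq> B.tgt e"
    using G[of "B.tgt e"] H[of "B.tgt e"] e1 bnd[of "B.tgt e" g] bnd[of "B.tgt e" h] ll'
    by (auto split: if_splits)
  have s: "l \<noteq> B.src e" "l' \<noteq> B.src e"
    using G[of "B.src e"] H[of "B.src e"] e1 bnd[of "B.src e" g] bnd[of "B.src e" h] ll'
    by (auto split: if_splits)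
  \<comment> \<open>The edge \<open>g\<close> would have its head both at \<open>l'\<close> and at
    the head of \<open>e\<close>.\<close>
  have "B.div_at l' g = 1" using G[of l'] s t ll' by (simp add: B.div_at_def[of _ e])
  then have "B.tgt g = l'" by (cases "B.tgt g = l'"; cases "B.src g = l'") (simp_all add: B.div_at_def)
  moreover have "B.div_at (B.tgt e) g = 1" using G[of "B.tgt e"] e1 t by simp
  then have "B.tgt g = B.tgt e" by (cases "B.tgt g = B.tgt e"; cases "B.src g = B.tgt e") (simp_all add: B.div_at_def)
  ultimately show False using t by simp
qed

end

section \<open>Alternating words and rank-one matrices\<close>

text \<open>Each letter is a column \<open>C d\<close> times a row \<open>R d\<close>, so a word
  collapses to scalar pairings at the junctions of consecutive letters.\<close>

lemma weval_rank_one: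
  assumes "\<And>d x y. x < k \<Longrightarrow> y < k \<Longrightarrow> A d x y = C d x * (R d y :: real)" "x < k" "y < k"
  shows "weval k A (d # w) x y = C d x * (\<Sum>m<k. R d m * weval k A w m y)"
  unfolding weval_Cons sum_distrib_left using assms by (intro sum.cong) auto

lemma weval_rank_one_Cons:
  assumes "\<And>d x y. x < k \<Longrightarrow> y < k \<Longrightarrow> A d x y = C d x * (R d y :: real)" "y < k"
  shows "(\<Sum>m<k. R d m * weval k A (d' # w) m y)
    = (\<Sum>m<k. R d m * C d' m) * (\<Sum>m<k. R d' m * weval k A w m y)"
proof -
  have "(\<Sum>m<k. R d m * weval k A (d' # w) m y)
      = (\<Sum>m<k. R d m * C d' m * (\<Sum>m<k. R d' m * weval k A w m y))"
    by (intro sum.cong refl) (simp add: weval_rank_one[where C = C and R = R] assms)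
  then show ?thesis by (simp only: sum_distrib_right)
qed

text \<open>The pairings are 0 for equal and 2 for different letters, so only alternating words
  survive; \<open>m\<close> is the number of junctions.\<close>

lemma weval_nilpotent:
  assumes A: "\<And>d x y. x < k \<Longrightarrow> y < k \<Longrightarrow> A d x y = C d x * (R d y :: real)"
    and K: "\<And>d. (\<Sum>m<k. R d m * C d m) = 0" "\<And>d. (\<Sum>m<k. R d m * C (swap_letter d) m) = 2"
    and xy: "x < k" "y < k" and w: "length w = Suc m"
  shows "weval k A w x y
    = (if w = alt (hd w) (swap_letter (hd w)) (Suc m) then 2 ^ m * C (hd w) x * R (last w) y else 0)"
proof -
  have rowv: "(\<Sum>l<k. R d l * weval k A w l y)
      = (if d # w = alt d (swap_letter d) (Suc m) then 2 ^ m * R (last (d # w)) y else 0)"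
    if "length w = m" for d w m
    using that
  proof (induction w arbitrary: d m)
    case Nil
    have "(\<Sum>l<k. R d l * weval k A [] l y) = (\<Sum>l\<in>{y}. R d l * weval k A [] l y)"
      by (rule sum.mono_neutral_right) (use xy in \<open>auto simp: weval_Nil\<close>)
    with Nil show ?case by (simp add: weval_Nil)
  next
    case (Cons d' w)
    then obtain m' where m': "m = Suc m'" "length w = m'" by auto
    have "(\<Sum>l<k. R d l * weval k A (d' # w) l y)
        = (\<Sum>l<k. R d l * C d' l) * (\<Sum>l<k. R d' l * weval k A w l y)"
      by (rule weval_rank_one_Cons) (use A xy in auto)
    also have "\<dots> = (if d' = swap_letter d then 2 else 0) * (\<Sum>l<k. R d' l * weval k A w l y)"
      using K neq_letter_iff[of d' d] by (cases "d' = d") auto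
    finally show ?case
      unfolding Cons.IH[OF m'(2)] by (auto simp: m')
  qed
  obtain d v where dv: "w = d # v" "length v = m" using w by (cases w) auto
  have "weval k A w x y = C d x * (\<Sum>l<k. R d l * weval k A v l y)"
    unfolding dv(1) by (rule weval_rank_one) (use A xy in auto)
  also have "\<dots> = C d x * (if d # v = alt d (swap_letter d) (Suc m) then 2 ^ m * R (last (d # v)) y else 0)"
    unfolding rowv[OF dv(2)] ..
  finally show ?thesis unfolding dv(1) by simp
qed

lemma last_alt_odd: "last (alt a b (Suc (2 * t))) = a"
  unfolding alt_odd by simp

text \<open>Odd length gives \<open>2 * t\<close> junctions, whence \<open>4 ^ t\<close>, and equal
  first and last letters.\<close>

lemma sum_words_nilpotent:
  assumes A: "\<And>d x y. x < k \<Longrightarrow> y < k \<Longrightarrow> A d x y = C d x * (R d y :: real)"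
    and K: "\<And>d. (\<Sum>m<k. R d m * C d m) = 0" "\<And>d. (\<Sum>m<k. R d m * C (swap_letter d) m) = 2"
    and xy: "x < k" "y < k"
  shows "(\<Sum>w\<in>words (Suc (2 * t)). c w * weval k A w x y)
    = 4 ^ t * (\<Sum>d\<in>UNIV. c (alt d (swap_letter d) (Suc (2 * t))) * C d x * R d y)"
proof -
  let ?n = "Suc (2 * t)" and ?W = "\<lambda>d. alt d (swap_letter d) (Suc (2 * t))"
  have v: "weval k A w x y = (if w = ?W (hd w) then 4 ^ t * C (hd w) x * R (last w) y else 0)"
    if "w \<in> words ?n" for w
  proof -
    have "weval k A w x y = (if w = ?W (hd w) then 2 ^ (2 * t) * C (hd w) x * R (last w) y else 0)"
      by (rule weval_nilpotent) (use A K xy that in \<open>auto simp: words_def\<close>)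
    then show ?thesis by (simp add: power_mult)
  qed
  have "(\<Sum>w\<in>words ?n. c w * weval k A w x y) = (\<Sum>w\<in>range ?W. c w * weval k A w x y)"
  proof (rule sum.mono_neutral_right)
    show "range ?W \<subseteq> words ?n" by (auto simp: words_def simp del: alt.simps)
    show "\<forall>w\<in>words ?n - range ?W. c w * weval k A w x y = 0"
    proof
      fix w assume w: "w \<in> words ?n - range ?W"
      then have "w \<noteq> ?W (hd w)" by blast
      with v[of w] w show "c w * weval k A w x y = 0" by simp
    qed
  qed simp
  also have "\<dots> = (\<Sum>d\<in>UNIV. c (?W d) * weval k A (?W d) x y)"
    by (subst sum.reindex) (auto simp: inj_on_def)
  also have "\<dots> = (\<Sum>d\<in>UNIV. c (?W d) * (4 ^ t * C d x * R d y))"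
  proof (intro sum.cong refl)
    fix d
    have "hd (?W d) = d" by simp
    then have "weval k A (?W d) x y = 4 ^ t * C d x * R d y"
      using v[of "?W d"] last_alt_odd[of d "swap_letter d" t] by (simp add: words_def del: alt.simps)
    then show "c (?W d) * weval k A (?W d) x y = c (?W d) * (4 ^ t * C d x * R d y)" by simp
  qed
  finally show ?thesis by (simp add: sum_distrib_left mult_ac)
qed

lemma sum_lessThan_two:
  fixes i i' :: nat
  assumes "i < 2" "i' < 2" "i \<noteq> i'"
  shows "(\<Sum>l<2. g l) = g i + (g i' :: real)"
proof -
  have "{..<2} = {i, i'}" using assms by auto
  with assms show ?thesis by simp
qed

text \<open>Matrices with rows \<open>(1, a)\<close> and \<open>(a, -1)\<close> are scaled
  reflections of the plane: an even number of factors gives a scaled rotation, an odd number a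
  scaled reflection, which is symmetric.\<close>

lemma weval_reflections:
  assumes ii': "i < 2" "i' < 2" "i \<noteq> i'"
    and A: "\<And>d. A d i i = 1" "\<And>d. A d i' i' = -1" "\<And>d. A d i i' = A d i' i"
  shows "if even (length w) then weval 2 A w i i = weval 2 A w i' i' \<and> weval 2 A w i i' = - weval 2 A w i' i
         else weval 2 A w i i = - weval 2 A w i' i' \<and> weval 2 A w i i' = (weval 2 A w i' i :: real)"
proof (induction w)
  case Nil
  then show ?case using ii' by (simp add: weval_Nil)
next
  case (Cons d w)
  then show ?case
    unfolding weval_Cons sum_lessThan_two[OF ii'] by (simp add: A algebra_simps split: if_splits)
qed

text \<open>The two matrices are either both nilpotent, or both symmetric and anticommuting; in the latter case
  words of odd length have symmetric values.\<close>

lemma reflection_pair_coefficient: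
  fixes c :: "letter list \<Rightarrow> real" and i i' :: nat
  assumes ii': "i < 2" "i' < 2" "i \<noteq> i'"
    and A: "\<And>d. A d i i = 1" "\<And>d. A d i' i' = (-1::real)"
      "\<And>d. \<bar>A d i i'\<bar> = 1" "\<And>d. \<bar>A d i' i\<bar> = 1"
    and zero: "(\<Sum>d\<in>UNIV. A d i i' + A d i' i) = 0" and "t \<ge> 1" "\<alpha> \<noteq> 0"
  defines "G \<equiv> \<lambda>x y. \<Sum>w\<in>words (Suc (2 * t)). c w * weval 2 A w x y"
  assumes G: "G i i = 4 ^ t * \<alpha>" "\<bar>G i i'\<bar> = 4 ^ t * \<bar>\<alpha>\<bar>" "G i i' = - G i' i"
  shows "c (alt LX LY (Suc (2 * t))) = \<alpha> \<or> c (alt LY LX (Suc (2 * t))) = \<alpha>"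
proof -
  have pm: "A d i i' = 1 \<or> A d i i' = -1" "A d i' i = 1 \<or> A d i' i = -1" for d
    using A(3,4)[of d] by (auto simp: abs_if split: if_splits)
  \<comment> \<open>Four signs have sum zero: if one letter has two equal signs, so has the
    other.\<close>
  consider (symm) "\<forall>d. A d i i' = A d i' i" | (nil) "\<forall>d. A d i' i = - A d i i'"
  proof -
    have all: "(\<forall>d. Q d) \<longleftrightarrow> Q LX \<and> Q LY" for Q by (metis letter.exhaust)
    have "(\<forall>d. A d i i' = A d i' i) \<or> (\<forall>d. A d i' i = - A d i i')"
      unfolding all using zero pm[of LX] pm[of LY] unfolding sum_letter by auto
    then show thesis using symm nil by blast
  qed
  then show ?thesis
  proof cases
    case symm
    have "G i i' = G i' i"
      unfolding G_def
    proof (intro sum.cong refl)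
      fix w assume "w \<in> words (Suc (2 * t))"
      then have "odd (length w)" by (simp add: words_def)
      then show "c w * weval 2 A w i i' = c w * weval 2 A w i' i"
        using weval_reflections[OF ii', of A w] A(1,2) symm by simp
    qed
    with G \<open>\<alpha> \<noteq> 0\<close> show ?thesis by simp
  next
    case nil
    \<comment> \<open>Opposite signs make the determinant zero: -1 is the product of the
      off-diagonal entries, so each matrix is a column times a row.\<close>
    define C R where "C = (\<lambda>d x. if x = i then 1 else A d i' i)" and "R = (\<lambda>d x. if x = i then 1 else A d i i')"
    have AC: "A d x y = C d x * R d y" if "x < 2" "y < 2" for d x y
    proof -
      have "x = i \<or> x = i'" "y = i \<or> y = i'" using that ii' by auto
      then show ?thesis using A(1,2)[of d] nil[rule_format, of d] pm[of d] ii' by (auto simp: C_def R_def)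
    qed
    have K: "(\<Sum>m<2. R d m * C d' m) = 1 - A d i i' * A d' i i'" for d d'
      unfolding sum_lessThan_two[OF ii'] using ii' by (simp add: C_def R_def nil)
    show ?thesis
    proof (cases "A LX i i' = A LY i i'")
      \<comment> \<open>The two matrices coincide, so every word with at least two letters
        vanishes.\<close>
      case True
      then have "A d i i' = A LX i i'" for d by (cases d) auto
      then have K0: "(\<Sum>m<2. R d m * C d' m) = 0" for d d'
        using K[of d d'] pm(1)[of LX] by (metis diff_self mult_1 mult_minus1 minus_minus)
      have "weval 2 A w i i = 0" if "w \<in> words (Suc (2 * t))" for w
      proof -
        have "length w \<ge> 2" using that \<open>t \<ge> 1\<close> by (simp add: words_def)
        then obtain d d' v where w: "w = d # d' # v"
          by (cases w; cases "tl w") auto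
        have "weval 2 A w i i = C d i * (\<Sum>m<2. R d m * weval 2 A (d' # v) m i)"
          unfolding w by (rule weval_rank_one) (use AC ii' in auto)
        also have "(\<Sum>m<2. R d m * weval 2 A (d' # v) m i)
            = (\<Sum>m<2. R d m * C d' m) * (\<Sum>m<2. R d' m * weval 2 A v m i)"
          by (rule weval_rank_one_Cons) (use AC ii' in auto)
        finally show ?thesis by (simp add: K0)
      qed
      then have "G i i = 0" unfolding G_def by simp
      with G \<open>\<alpha> \<noteq> 0\<close> show ?thesis by simp
    next
      case False
      then have YX: "A LY i i' = - A LX i i'" using pm(1)[of LX] pm(1)[of LY] by auto
      have "A (swap_letter d) i i' = - A d i i'" for d using YX by (cases d) auto
      moreover have "A d i i' * A d i i' = 1" for d using pm(1)[of d] by auto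
      ultimately have K': "(\<Sum>m<2. R d m * C d m) = 0" "(\<Sum>m<2. R d m * C (swap_letter d) m) = 2" for d
        using K by simp_all
      have Gxy: "G x y = 4 ^ t * (\<Sum>d\<in>UNIV. c (alt d (swap_letter d) (Suc (2 * t))) * C d x * R d y)"
        if "x < 2" "y < 2" for x y
        unfolding G_def by (rule sum_words_nilpotent) (use AC K' that in auto)
      define d3 d4 where "d3 = c (alt LX LY (Suc (2 * t)))" and "d4 = c (alt LY LX (Suc (2 * t)))"
      have "4 ^ t * (d3 + d4) = 4 ^ t * \<alpha>"
        using Gxy[of i i] ii' G(1) by (simp add: sum_letter C_def R_def d3_def d4_def)
      moreover have "\<bar>G i i'\<bar> = 4 ^ t * \<bar>d3 - d4\<bar>"
        using Gxy[of i i'] ii' pm(1)[of LX]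
        by (auto simp: sum_letter C_def R_def d3_def d4_def YX abs_mult abs_minus_commute simp del: alt.simps)
      \<comment> \<open>Sum and difference of equal absolute value force one of \<open>d3\<close>,
        \<open>d4\<close> to be 0.\<close>
      ultimately have "d3 + d4 = \<alpha>" "\<bar>d3 - d4\<bar> = \<bar>\<alpha>\<bar>" using G(2) by simp_all
      then have "d3 = \<alpha> \<or> d4 = \<alpha>" by (auto simp: abs_if split: if_splits)
      then show ?thesis by (simp add: d3_def d4_def)
    qed
  qed
qed

section \<open>Powers of a single variable\<close>

context grid
begin

text \<open>A balance that is divisible by \<open>n\<close>, at least 2, and bounded by 1 vanishes,
  so such powers occur only for loops.\<close>

lemma coef_pure_eq_0:
  assumes "2 \<le> n" "i \<noteq> j \<or> src x \<noteq> i \<or> tgt x \<noteq> i"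
  shows "coef c (replicate_mset n x) i j = 0"
proof (rule ccontr)
  assume "coef c (replicate_mset n x) i j \<noteq> 0"
  then obtain xs where xs: "mset xs = replicate_mset n x" "walk i xs j"
    by (rule coef_nonzero_walk)
  have D: "int n * div_at v x = of_bool (j = v) - of_bool (i = v)" for v
    using walk_divergence[OF xs(2), of v] by (simp add: xs(1))
  have "div_at v x = 0" for v
  proof (rule ccontr)
    assume "div_at v x \<noteq> 0"
    then have "\<bar>int n * div_at v x\<bar> \<ge> 2"
      using div_at_cases[of v x] assms(1) by auto
    then show False unfolding D by (auto simp: of_bool_def split: if_splits)
  qed
  then have "j = i" "src x = tgt x"
    using D[of j] by (auto simp: div_at_def of_bool_def split: if_splits)
       (metis (full_types) zero_neq_one)
  moreover have "x \<in> set xs" using assms(1) xs(1)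
    by (metis set_mset_mset in_replicate_mset not_numeral_le_zero neq0_conv)
  ultimately show False
    using walk_loops[OF xs(2)] assms(2) xs(1)
    by (metis in_replicate_mset set_mset_mset)
qed

lemma coef_pure_loop:
  assumes "i < k"
  shows "coef c (replicate_mset n (E a i i)) i i = c (replicate n a)"
proof -
  have "permutations_of_multiset (replicate_mset n (E a i i)) = {replicate n (E a i i)}"
  proof (intro equalityI subsetI)
    fix xs assume "xs \<in> permutations_of_multiset (replicate_mset n (E a i i))"
    then have M: "mset xs = replicate_mset n (E a i i)" by (simp add: permutations_of_multiset_def)
    then have "length xs = n" by (metis size_mset size_replicate_mset)
    moreover have "\<forall>x\<in>set xs. x = E a i i"
      using M by (metis in_replicate_mset set_mset_mset)
    ultimately show "xs \<in> {replicate n (E a i i)}"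
      by (simp add: replicate_eqI)
  qed (simp add: permutations_of_multiset_def)
  moreover have "walk i (replicate n (E a i i)) i"
    by (induction n) (use assms in auto)
  ultimately have "{xs \<in> permutations_of_multiset (replicate_mset n (E a i i)). walk i xs i} = {replicate n (E a i i)}"
    by auto
  then show ?thesis using assms by (simp add: coef_def)
qed

lemma sum_V: "(\<Sum>x\<in>V. z x) = (\<Sum>a\<in>UNIV. \<Sum>i<k. \<Sum>j<k. z (E a i j))"
proof -
  have "(\<Sum>x\<in>V. z x) = (\<Sum>(a, i, j)\<in>UNIV \<times> {..<k} \<times> {..<k}. z (E a i j))"
    using sum.reindex_bij_betw[OF bij, of z] by (simp add: case_prod_unfold)
  then show ?thesis by (simp add: sum.cartesian_product)
qed

end

lemma alt_same: "alt a a n = replicate n a"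
  by (induction n) auto

context two_reps
begin

lemma pi_inj:
  assumes "\<pi> (i, j) = \<pi> (i', j')" "i < k" "j < k" "i' < k" "j' < k"
  shows "i = i' \<and> j = j'"
  using bij_betw_imp_inj_on[OF pi_bij] assms unfolding inj_on_def by blast

lemma pi_surj:
  assumes "i < k" "j < k"
  obtains p q where "p < k" "q < k" "\<pi> (p, q) = (i, j)"
proof -
  have "(i, j) \<in> \<pi> ` ({..<k} \<times> {..<k})"
    using pi_bij assms unfolding bij_betw_def by simp
  then show thesis using that by auto
qed

text \<open>If the loops at \<open>i\<close> became opposite edges, then every off-diagonal entry of the second representation
  would be a diagonal entry of the first, so that \<open>k = 2\<close>.\<close>

lemma list2_matches:
  assumes i: "i < k" and t: "t \<ge> 2" and phi: "type_sum c (Suc t) t \<noteq> 0"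
    and asym: "type_sum c (Suc t) t \<noteq> type_sum c t (Suc t)"
    and d3: "type_sum c (Suc t) t \<noteq> c (alt LX LY (Suc (2 * t)))"
    and d4: "type_sum c (Suc t) t \<noteq> c (alt LY LX (Suc (2 * t)))"
  shows "\<exists>j. matches i j"
proof (rule ccontr)
  assume neg: "\<nexists>j. matches i j"
  let ?n = "Suc (2 * t)"
  define \<alpha> where "\<alpha> = type_sum c (Suc t) t"
  define e f where "e = E LX i i" and "f = E LY i i"
  have ef: "e \<in> V" "f \<in> V" using i by (simp_all add: e_def f_def)
  define j l where "j = B.src e" and "l = B.tgt e"
  have st2: "Suc t \<ge> 2" using t by simp
  have opp: "j \<noteq> l" "B.src f = l" "B.tgt f = j" "fst (\<pi> (i, i)) = j" "snd (\<pi> (i, i)) = l"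
    using loop_monomial[OF i phi st2 t] neg by (auto simp: e_def f_def j_def l_def)
  have jl: "j < k" "l < k" using ef by (simp_all add: j_def l_def)
  have pii: "\<pi> (i, i) = (j, l)" using opp(4,5) by (simp add: prod_eq_iff)
  define a b where "a = B.lab e" and "b = B.lab f"
  have e: "e = E' a j l" and f: "f = E' b l j"
    using B.E_lab[OF ef(1)] B.E_lab[OF ef(2)] opp(2,3) by (simp_all add: a_def b_def j_def l_def)
  have n2: "2 \<le> ?n" using t by simp

  have coef_transfer: "B.coef c' M p' q' = A.coef c M p q"
    if "set_mset M \<subseteq> V" "p < k" "q < k" "\<pi> (p, q) = (p', q')" for M p q p' q'
    using coef_eq[OF that(2,3,1)] that(4) by simp

  \<comment> \<open>Powers of the loops at \<open>i\<close> belong to the off-diagonal entry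
    \<open>(j, l)\<close> of the second grid, where no such power occurs.\<close>
  have pure: "c (replicate ?n d) = 0" for d
  proof -
    have "c (replicate ?n d) = A.coef c (replicate_mset ?n (E d i i)) i i"
      using i by (simp only: A.coef_pure_loop)
    also have "\<dots> = B.coef c' (replicate_mset ?n (E d i i)) j l"
      by (rule coef_transfer[symmetric]) (use i pii in \<open>auto split: if_splits\<close>)
    also have "\<dots> = 0" using B.coef_pure_eq_0[OF n2] opp(1) by blast
    finally show ?thesis .
  qed
  have pure': "c' (replicate ?n d) = 0" for d
  proof -
    obtain p q where pq: "p < k" "q < k" "\<pi> (p, q) = (j, j)" using pi_surj[OF jl(1) jl(1)] .
    let ?x = "E' d j j"
    have "c' (replicate ?n d) = B.coef c' (replicate_mset ?n ?x) j j"
      using jl by (simp only: B.coef_pure_loop)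
    also have "\<dots> = A.coef c (replicate_mset ?n ?x) p q"
      by (rule coef_transfer) (use jl pq in \<open>auto split: if_splits\<close>)
    also have "\<dots> = 0"
    proof (rule ccontr)
      assume *: "A.coef c (replicate_mset ?n ?x) p q \<noteq> 0"
      then have "p = q" "A.src ?x = p" "A.tgt ?x = p"
        using A.coef_pure_eq_0[OF n2] by blast+
      moreover then have "?x = E (A.lab ?x) p p"
        using A.E_lab[of ?x] jl by simp
      ultimately show False
        using * A.coef_pure_loop[OF pq(1)] pure by metis
    qed
    finally show ?thesis .
  qed
  have off_coef: "B.coef c' (replicate_mset (Suc t) (E' d j' l') + replicate_mset t (E' d' l' j')) j' l'
      = c' (alt d d' ?n)" if "j' < k" "l' < k" "j' \<noteq> l'" for d d' j' l'
    using B.coef_opposite[of "E' d j' l'" "E' d' l' j'" c' t] that by (simp del: alt.simps replicate_mset_Suc)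
  \<comment> \<open>In the second grid the same monomial has one walk only, so the whole sum
    \<open>\<alpha>\<close> is a single coefficient.\<close>
  have \<alpha>: "c' (alt a b ?n) = \<alpha>"
  proof -
    have "c' (alt a b ?n) = B.coef c' (replicate_mset (Suc t) e + replicate_mset t f) j l"
      unfolding e f by (rule off_coef[symmetric]) (use jl opp in auto)
    also have "\<dots> = A.coef c (replicate_mset (Suc t) e + replicate_mset t f) i i"
      by (rule coef_transfer) (use ef i pii in \<open>auto split: if_splits\<close>)
    also have "\<dots> = \<alpha>" unfolding e_def f_def \<alpha>_def by (rule A.coef_loops[OF i])
    finally show ?thesis .
  qed
  have \<alpha>0: "\<alpha> \<noteq> 0" using phi by (simp add: \<alpha>_def)
  have ab: "b = swap_letter a"
  proof (rule ccontr)
    assume "b \<noteq> swap_letter a"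
    then have "b = a" using neq_letter_iff[of b a] by blast
    then show False using \<alpha> \<alpha>0 pure' by (simp add: alt_same del: alt.simps replicate.simps)
  qed

  \<comment> \<open>Opposite edges in the first grid would make \<open>\<alpha>\<close> the
    coefficient of an alternating word, excluded by \<open>d3\<close> and \<open>d4\<close>, or of a
    pure power, which is 0.\<close>
  have off_loops: "p = q \<and> A.src x = p \<and> A.tgt x = p \<and> A.src y = p \<and> A.tgt y = p"
    if j'l': "j' < k" "l' < k" "j' \<noteq> l'" and pq: "p < k" "q < k" "\<pi> (p, q) = (j', l')"
      and xy: "x = E' a j' l'" "y = E' b l' j'" for j' l' p q x y
  proof -
    let ?M = "replicate_mset (Suc t) x + replicate_mset t y"
    have V: "x \<in> V" "y \<in> V" using j'l' xy by simp_all
    have A: "A.coef c ?M p q = \<alpha>"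
      using coef_transfer[of ?M p q j' l'] off_coef[OF j'l', of a b] \<alpha> pq V xy by (auto split: if_splits)
    then obtain xs where "mset xs = ?M" "A.walk p xs q"
      using \<alpha>0 A.coef_nonzero_walk by metis
    from A.walk_two_edges[OF this(2,1) st2 t] show ?thesis
    proof
      assume *: "A.src x \<noteq> A.tgt x \<and> A.src y = A.tgt x \<and> A.tgt y = A.src x \<and>
        (Suc t = t \<and> p = q \<or> Suc t = Suc t \<and> p = A.src x \<and> q = A.tgt x \<or> t = Suc (Suc t) \<and> p = A.src y \<and> q = A.tgt y)"
      then have "p = A.src x" "q = A.tgt x" by auto
      then have "\<alpha> = c (alt (A.lab x) (A.lab y) ?n)"
        using A.coef_opposite[of x y c t] * A by simp
      moreover have "c (alt (A.lab x) (A.lab y) ?n) \<noteq> \<alpha>"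
      proof (cases "A.lab x = A.lab y")
        case True
        then show ?thesis using pure \<alpha>0 by (simp add: alt_same del: alt.simps replicate.simps)
      next
        case False
        then have "A.lab y = swap_letter (A.lab x)" using neq_letter_iff[of "A.lab y" "A.lab x"] by simp
        then show ?thesis using d3 d4 by (cases "A.lab x") (auto simp: \<alpha>_def simp del: alt.simps)
      qed
      ultimately show ?thesis by simp
    qed auto
  qed

  define D Q where "D = (\<lambda>x. (x, x)) ` {..<k}" and "Q = {..<k} \<times> {..<k} - D"
  have injd: "inj_on (\<lambda>x. (x, x)) {..<k}" by (auto simp: inj_on_def)
  have injD: "inj_on \<pi> D"
    by (rule inj_on_subset[OF bij_betw_imp_inj_on[OF pi_bij]]) (auto simp: D_def)
  have cD: "card D = k" unfolding D_def by (simp add: card_image[OF injd])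
  have cO: "card Q = k * k - k"
    unfolding Q_def by (subst card_Diff_subset) (auto simp: cD D_def card_cartesian_product card_image[OF injd])
  have sub: "Q \<subseteq> \<pi> ` D"
  proof
    fix z assume "z \<in> Q"
    then obtain j' l' where z: "z = (j', l')" "j' < k" "l' < k" "j' \<noteq> l'"
      by (auto simp: Q_def D_def)
    obtain p q where pq: "p < k" "q < k" "\<pi> (p, q) = (j', l')" using pi_surj[OF z(2,3)] .
    have "p = q" using off_loops[OF z(2,3,4) pq refl refl] by blast
    then have "z = \<pi> (p, p)" using pq(3) z(1) by simp
    moreover have "(p, p) \<in> D" using pq(1) by (simp add: D_def)
    ultimately show "z \<in> \<pi> ` D" by blast
  qed
  \<comment> \<open>All \<open>k * k - k\<close> off-diagonal positions are images of the
    \<open>k\<close> diagonal ones.\<close>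
  have "k * k - k \<le> k"
    using card_mono[OF _ sub] card_image[OF injD] cD cO by (simp add: D_def)
  moreover have "k \<ge> 2" using jl opp(1) by linarith
  ultimately have "k * k \<le> 2 * k" by linarith
  with \<open>k \<ge> 2\<close> have k2: "k = 2" by simp
  have OD: "Q = \<pi> ` D"
    by (rule card_subset_eq) (use sub card_image[OF injD] cD cO k2 in \<open>auto simp: D_def\<close>)

  define i' where "i' = 1 - i"
  have i': "i' < k" "i' \<noteq> i"
    using k2 i unfolding i'_def by arith+
  have two: "x = i \<or> x = i'" if "x < k" for x using that i i' k2 by linarith
  have twoB: "x = j \<or> x = l" if "x < k" for x using that jl opp(1) k2 by linarith
  have pi'i': "\<pi> (i', i') = (l, j)"
  proof -
    have "\<pi> (i', i') \<in> Q" using OD i' by (auto simp: D_def)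
    then obtain u v where uv: "\<pi> (i', i') = (u, v)" "u < k" "v < k" "u \<noteq> v" by (auto simp: Q_def D_def)
    moreover have "(u, v) \<noteq> (j, l)" using pi_inj[of i' i' i i] uv(1) pii i i' by auto
    ultimately show ?thesis using twoB[of u] twoB[of v] by auto
  qed
  have diag_pi: "\<pi> (p, q) = (j, j) \<or> \<pi> (p, q) = (l, l)" if pq: "p < k" "q < k" "p \<noteq> q" for p q
  proof -
    have "\<pi> (p, q) \<notin> Q"
    proof
      assume "\<pi> (p, q) \<in> Q"
      then obtain x where "x < k" "\<pi> (p, q) = \<pi> (x, x)" unfolding OD D_def by auto
      then show False using pi_inj[of p q x x] pq by auto
    qed
    then have "fst (\<pi> (p, q)) = snd (\<pi> (p, q))"
      using pi_less[OF pq(1,2)] by (auto simp: Q_def D_def image_iff mem_Times_iff prod_eq_iff)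
    then show ?thesis using twoB[OF pi_less(1)[OF pq(1,2)]] by (auto simp: prod_eq_iff)
  qed

  define x y where "x = E' a l j" and "y = E' b j l"
  have xyV: "x \<in> V" "y \<in> V" using jl by (simp_all add: x_def y_def)
  have lj: "l \<noteq> j" using opp(1) by simp
  have xyi': "A.src x = i'" "A.tgt x = i'" "A.src y = i'" "A.tgt y = i'"
    using off_loops[OF jl(2,1) lj i'(1) i'(1) pi'i' x_def y_def] by blast+
  have xE: "x = E (A.lab x) i' i'" and yE: "y = E (A.lab y) i' i'"
    using A.E_lab[OF xyV(1)] A.E_lab[OF xyV(2)] xyi' by simp_all
  have "x \<noteq> y" using jl opp(1) by (simp add: x_def y_def)
  then have "A.lab x \<noteq> A.lab y" using xE yE by metis
  \<comment> \<open>The monomial of the reversed word is read in the entry \<open>(l, j)\<close>,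
    the image of \<open>(i', i')\<close>, but it consists of loops at \<open>i\<close>.\<close>
  have c'ba: "c' (alt b a ?n) = 0"
  proof -
    have "c' (alt b a ?n) = B.coef c' (replicate_mset (Suc t) f + replicate_mset t e) l j"
      unfolding e f by (rule off_coef[symmetric]) (use jl opp in auto)
    also have "\<dots> = A.coef c (replicate_mset (Suc t) f + replicate_mset t e) i' i'"
      by (rule coef_transfer) (use ef i' pi'i' in \<open>auto split: if_splits\<close>)
    also have "\<dots> = 0"
    proof (rule ccontr)
      assume "\<not> ?thesis"
      then obtain xs where "mset xs = replicate_mset (Suc t) f + replicate_mset t e" "A.walk i' xs i'"
        using A.coef_nonzero_walk by metis
      from A.walk_two_edges[OF this(2,1) st2 t] show False
        using i i' by (auto simp: e_def f_def)
    qed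
    finally show ?thesis .
  qed

  text \<open>In the second representation the variables are specialised so that both matrices become
    nilpotent of rank one, which leaves only the two alternating words.\<close>
  define C R :: "letter \<Rightarrow> nat \<Rightarrow> real"
    where "C = (\<lambda>d m. if d = a \<or> m \<noteq> j then 1 else -1)"
      and "R = (\<lambda>d m. if d = b \<or> m \<noteq> j then 1 else -1)"
  define z where "z = (\<lambda>x. C (B.lab x) (B.src x) * R (B.lab x) (B.tgt x))"
  have zE': "z (E' d p q) = C d p * R d q" if "p < k" "q < k" for d p q
    using that by (simp add: z_def)
  have sum2: "(\<Sum>m<k. g m) = g j + (g l :: real)" for g
    unfolding k2 by (rule sum_lessThan_two) (use jl opp k2 in auto)
  have ab': "a \<noteq> b" "b \<noteq> a" using ab by auto
  have d_cases: "d = a \<or> d = b" for d using ab neq_letter_iff[of d a] by blast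
  have offs: "swap_letter a = b" "swap_letter b = a" using ab by simp_all
  have K: "(\<Sum>m<k. R d m * C d m) = 0" "(\<Sum>m<k. R d m * C (swap_letter d) m) = 2" for d
    unfolding sum2 using d_cases[of d] lj ab' by (auto simp: C_def R_def offs)
  have evB: "B.ev ?n c' z p q = 4 ^ t * \<alpha> * C a p * R a q" if pq: "p < k" "q < k" for p q
  proof -
    have "B.ev ?n c' z p q = 4 ^ t * (\<Sum>d\<in>UNIV. c' (alt d (swap_letter d) ?n) * C d p * R d q)"
      unfolding B.ev_def by (rule sum_words_nilpotent) (use K zE' pq in auto)
    also have "(\<Sum>d\<in>UNIV. c' (alt d (swap_letter d) ?n) * C d p * R d q) = (\<Sum>d\<in>{a, b}. c' (alt d (swap_letter d) ?n) * C d p * R d q)"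
      by (rule sum.cong) (use d_cases in auto)
    also have "\<dots> = \<alpha> * C a p * R a q"
      using ab' \<alpha> c'ba by (simp add: offs del: alt.simps)
    finally show ?thesis by simp
  qed
  have evA: "A.ev ?n c z p q = 4 ^ t * \<alpha> * C a (fst (\<pi> (p, q))) * R a (snd (\<pi> (p, q)))"
    if "p < k" "q < k" for p q
    using ev_eq[OF that] evB[OF pi_less[OF that]] by simp
  let ?A = "\<lambda>d p q. z (E d p q)"
  \<comment> \<open>The signs are arranged so that in the first grid the loops at \<open>i\<close>
    get 1 and those at \<open>i'\<close> get -1, in both colours.\<close>
  have Aii: "?A d i i = 1" for d
  proof (cases d)
    case LX
    then have "?A d i i = z (E' a j l)" using e by (simp add: e_def)
    then show ?thesis using zE'[OF jl] lj ab' by (simp add: C_def R_def)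
  next
    case LY
    then have "?A d i i = z (E' b l j)" using f by (simp add: f_def)
    then show ?thesis using zE'[OF jl(2,1)] lj ab' by (simp add: C_def R_def)
  qed
  have zxy: "z x = -1" "z y = -1"
    using zE'[OF jl] zE'[OF jl(2,1)] lj ab' by (simp_all add: C_def R_def x_def y_def)
  have Ai'i': "?A d i' i' = -1" for d
  proof -
    have "d = A.lab x \<or> d = A.lab y"
      using \<open>A.lab x \<noteq> A.lab y\<close> neq_letter_iff by metis
    then show ?thesis using zxy xE yE by metis
  qed
  have CR: "\<bar>C d m\<bar> = 1" "\<bar>R d m\<bar> = 1" for d m by (simp_all add: C_def R_def)
  have zabs: "\<bar>z v\<bar> = 1" for v by (simp add: z_def abs_mult CR)
  have sumA: "(\<Sum>m<k. g m) = g i + (g i' :: real)" for g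
    unfolding k2 by (rule sum_lessThan_two) (use i i' k2 in auto)
  \<comment> \<open>The sum over all variables factors in the second grid, with a factor 0 for each
    colour; in the first grid the diagonal entries cancel.\<close>
  have zero: "(\<Sum>d\<in>UNIV. ?A d i i' + ?A d i' i) = 0"
  proof -
    have "(\<Sum>v\<in>V. z v) = (\<Sum>d\<in>UNIV. \<Sum>p<k. \<Sum>q<k. C d p * R d q)"
      unfolding B.sum_V by (intro sum.cong refl) (simp add: zE')
    also have "\<dots> = (\<Sum>d\<in>UNIV. (C d j + C d l) * (R d j + R d l))"
      unfolding sum2 by (simp add: algebra_simps)
    also have "\<dots> = 0"
      by (rule sum.neutral) (use d_cases lj ab' in \<open>auto simp: C_def R_def\<close>)
    finally have "(\<Sum>v\<in>V. z v) = 0" .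
    then show ?thesis
      unfolding A.sum_V sumA using Aii Ai'i' by (simp add: algebra_simps)
  qed
  have "c (alt LX LY ?n) = \<alpha> \<or> c (alt LY LX ?n) = \<alpha>"
  proof (rule reflection_pair_coefficient[where A = ?A and i = i and i' = i'])
    have G: "(\<Sum>w\<in>words ?n. c w * weval 2 ?A w p q) = A.ev ?n c z p q" for p q
      by (simp only: A.ev_def k2[symmetric])
    show "(\<Sum>w\<in>words ?n. c w * weval 2 ?A w i i) = 4 ^ t * \<alpha>"
      unfolding G evA[OF i i] pii using lj ab' by (simp add: C_def R_def)
    show "\<bar>\<Sum>w\<in>words ?n. c w * weval 2 ?A w i i'\<bar> = 4 ^ t * \<bar>\<alpha>\<bar>"
      unfolding G evA[OF i i'(1)] by (simp add: abs_mult CR)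
    have v: "C a j * R a j = -1" "C a l * R a l = 1" using lj ab' by (simp_all add: C_def R_def)
    have ne: "\<pi> (i, i') \<noteq> \<pi> (i', i)" using pi_inj[of i i' i' i] i i' by auto
    \<comment> \<open>The two off-diagonal entries go to \<open>(j, j)\<close> and
      \<open>(l, l)\<close> in some order, where the values have opposite signs.\<close>
    show "(\<Sum>w\<in>words ?n. c w * weval 2 ?A w i i') = - (\<Sum>w\<in>words ?n. c w * weval 2 ?A w i' i)"
      unfolding G evA[OF i i'(1)] evA[OF i'(1) i]
      using diag_pi[OF i i'(1)] diag_pi[OF i'(1) i] ne i'(2) v by (auto simp: mult.assoc)
  qed (use i i' k2 Aii Ai'i' zabs zero t \<alpha>0 in auto)
  then show False using d3 d4 by (auto simp: \<alpha>_def)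
qed

end

section \<open>The class Q\<close>

lemma word_prod_cnt: "word_prod g w = g LX ^ cnt LX w * g LY ^ cnt LY w"
proof (induction w)
  case (Cons a w)
  then show ?case by (cases a) (auto simp: algebra_simps)
qed simp

lemma comm_part_type_sum: "comm_part n c g = (\<Sum>s\<le>n. type_sum c s (n - s) * g LX ^ s * g LY ^ (n - s))"
proof -
  have "comm_part n c g = (\<Sum>s\<le>n. \<Sum>w\<in>{w\<in>words n. cnt LX w = s}. c w * word_prod g w)"
    unfolding comm_part_def
  proof (rule sum.group[symmetric])
    show "cnt LX ` words n \<subseteq> {..n}" by (auto simp: words_def cnt_add_length[symmetric])
  qed simp_all
  also have "\<dots> = (\<Sum>s\<le>n. type_sum c s (n - s) * g LX ^ s * g LY ^ (n - s))"
  proof (intro sum.cong refl)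
    fix s assume "s \<in> {..n}"
    then have "{w\<in>words n. cnt LX w = s} = words_of_type s (n - s)"
      by (auto simp: words_def words_of_type_def cnt_add_length[symmetric])
    then show "(\<Sum>w\<in>{w\<in>words n. cnt LX w = s}. c w * word_prod g w) = type_sum c s (n - s) * g LX ^ s * g LY ^ (n - s)"
      by (simp add: type_sum_def sum_distrib_right word_prod_cnt words_of_type_def mult.assoc)
  qed
  finally show ?thesis .
qed

lemma polyfun_eqD:
  fixes a b :: "nat \<Rightarrow> real"
  assumes "\<And>x. (\<Sum>s\<le>n. a s * x ^ s) = (\<Sum>s\<le>n. b s * x ^ s)" "s \<le> n"
  shows "a s = b s"
  using assms polyfun_eq_coeffs[of a n b] by blast

lemma comm_part_at_one: "comm_part n c (case_letter x 1) = (\<Sum>s\<le>n. type_sum c s (n - s) * x ^ s)"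
  by (simp add: comm_part_type_sum)

lemma comm_part_at_zero:
  assumes "n > 0"
  shows "comm_part n c (case_letter x 0) = type_sum c n 0 * x ^ n"
proof -
  have "comm_part n c (case_letter x 0) = (\<Sum>s\<in>{n}. type_sum c s (n - s) * x ^ s * 0 ^ (n - s))"
    unfolding comm_part_type_sum by (rule sum.mono_neutral_cong_right) auto
  then show ?thesis by simp
qed

lemma comm_part_not_affine:
  assumes "type_sum c s t \<noteq> 0" "s \<ge> 2"
  shows "\<not> (\<exists>\<alpha> \<beta>. \<forall>g. comm_part (s + t) c g = \<alpha> + (\<Sum>a\<in>UNIV. \<beta> a * g a))"
proof clarify
  fix \<alpha> \<beta> assume *: "\<forall>g. comm_part (s + t) c g = \<alpha> + (\<Sum>a\<in>UNIV. \<beta> a * g a)"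
  let ?b = "\<lambda>s. if s = 0 then \<alpha> + \<beta> LY else if s = 1 then \<beta> LX else 0"
  have "(\<Sum>r\<le>s + t. type_sum c r (s + t - r) * x ^ r) = (\<Sum>r\<le>s + t. ?b r * x ^ r)" for x :: real
  proof -
    have "(\<Sum>r\<le>s + t. ?b r * x ^ r) = (\<Sum>r\<in>{0, 1}. ?b r * x ^ r)"
      by (rule sum.mono_neutral_right) (use assms in auto)
    also have "\<dots> = comm_part (s + t) c (case_letter x 1)" by (simp add: * sum_letter)
    finally show ?thesis by (simp add: comm_part_at_one)
  qed
  from polyfun_eqD[OF this, of s] assms show False by simp
qed

lemma comm_part_depends:
  assumes "type_sum c s t \<noteq> 0" "s > 0" "t > 0"
  shows "\<exists>g h. (\<forall>b. b \<noteq> a \<longrightarrow> g b = h b) \<and> comm_part (s + t) c g \<noteq> comm_part (s + t) c h"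
proof (rule ccontr)
  assume neg: "\<not> ?thesis"
  show False
  proof (cases a)
    case LX
    have "comm_part (s + t) c (case_letter x 1) = comm_part (s + t) c (case_letter 0 1)" for x
    proof -
      have "\<forall>b. b \<noteq> LX \<longrightarrow> (case_letter x 1 :: letter \<Rightarrow> real) b = case_letter 0 1 b"
        by (auto split: letter.splits)
      with neg LX show ?thesis by blast
    qed
    then have "(\<Sum>r\<le>s + t. type_sum c r (s + t - r) * x ^ r) = (\<Sum>r\<le>s + t. (if r = 0 then comm_part (s + t) c (case_letter 0 1) else 0) * x ^ r)" for x
      by (simp add: comm_part_at_one[symmetric] if_distrib[of "\<lambda>u. u * _"] sum.delta cong: if_cong)
    from polyfun_eqD[OF this, of s] assms show False by simp
  next
    case LY
    have "comm_part (s + t) c (case_letter x 1) = comm_part (s + t) c (case_letter x 0)" for x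
    proof -
      have "\<forall>b. b \<noteq> LY \<longrightarrow> (case_letter x 1 :: letter \<Rightarrow> real) b = case_letter x 0 b"
        by (auto split: letter.splits)
      with neg LY show ?thesis by blast
    qed
    then have "(\<Sum>r\<le>s + t. type_sum c r (s + t - r) * x ^ r) = (\<Sum>r\<le>s + t. (if r = s + t then type_sum c (s + t) 0 else 0) * x ^ r)" for x
      using assms by (simp add: comm_part_at_one[symmetric] comm_part_at_zero if_distrib[of "\<lambda>u. u * _"] sum.delta cong: if_cong)
    from polyfun_eqD[OF this, of s] assms show False by simp
  qed
qed

text \<open>A function of the sum is symmetric, hence has symmetric coefficients.\<close>

lemma comm_part_not_sum_asym:
  assumes "type_sum c s t \<noteq> type_sum c t s"
  shows "\<exists>g h. g LX + g LY = h LX + h LY \<and> comm_part (s + t) c g \<noteq> comm_part (s + t) c h"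
proof (rule ccontr)
  assume neg: "\<not> ?thesis"
  have "(\<Sum>r\<le>s + t. type_sum c r (s + t - r) * x ^ r) = (\<Sum>r\<le>s + t. type_sum c (s + t - r) r * x ^ r)" for x
  proof -
    have "(case_letter x 1 :: letter \<Rightarrow> real) LX + case_letter x 1 LY = case_letter 1 x LX + case_letter 1 x LY" by simp
    with neg have "comm_part (s + t) c (case_letter x 1) = comm_part (s + t) c (case_letter 1 x)" by blast
    also have "\<dots> = (\<Sum>r\<le>s + t. type_sum c r (s + t - r) * x ^ (s + t - r))" by (simp add: comm_part_type_sum)
    also have "\<dots> = (\<Sum>r\<le>s + t. type_sum c (s + t - r) r * x ^ r)"
      by (rule sum.reindex_bij_witness[where i = "\<lambda>r. s + t - r" and j = "\<lambda>r. s + t - r"]) auto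
    finally show ?thesis by (simp add: comm_part_at_one)
  qed
  from polyfun_eqD[OF this, of s] assms show False by simp
qed

text \<open>A function of the sum is determined by its values on the first axis, where only the pure
  power survives.\<close>

lemma comm_part_not_sum_pure:
  assumes "type_sum c s t \<noteq> 0" "type_sum c (s + t) 0 = 0" "s + t > 0"
  shows "\<exists>g h. g LX + g LY = h LX + h LY \<and> comm_part (s + t) c g \<noteq> comm_part (s + t) c h"
proof (rule ccontr)
  assume neg: "\<not> ?thesis"
  have "(\<Sum>r\<le>s + t. type_sum c r (s + t - r) * x ^ r) = (\<Sum>r\<le>s + t. 0 * x ^ r)" for x
  proof -
    have "(case_letter x 1 :: letter \<Rightarrow> real) LX + case_letter x 1 LY = case_letter (x + 1) 0 LX + case_letter (x + 1) 0 LY" by simp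
    with neg have "comm_part (s + t) c (case_letter x 1) = comm_part (s + t) c (case_letter (x + 1) 0)" by blast
    also have "\<dots> = 0" using assms by (simp add: comm_part_at_zero)
    finally show ?thesis by (simp add: comm_part_at_one)
  qed
  from polyfun_eqD[OF this, of s] assms show False by simp
qed

section \<open>Reading off the three lists\<close>

lemma phi_eq_type_sum: "phi p s t = type_sum (Poly_Mapping.lookup p) s t"
  by (simp add: phi_def type_sum_def)

lemma words_of_type_last:
  "{w \<in> words_of_type s t. w \<noteq> [] \<and> last w = a}
     = (\<lambda>w. w @ [a]) ` {w. w @ [a] \<in> words_of_type s t}"
proof (intro equalityI subsetI)
  fix w assume w: "w \<in> {w \<in> words_of_type s t. w \<noteq> [] \<and> last w = a}"
  then have "w = butlast w @ [a]" by auto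
  with w show "w \<in> (\<lambda>w. w @ [a]) ` {w. w @ [a] \<in> words_of_type s t}" by auto
qed auto

lemma phi_end_LX: "phi_end p (Suc s) t LX = (\<Sum>w\<in>words_of_type s t. Poly_Mapping.lookup p (w @ [LX]))"
  and phi_end_LY: "phi_end p s (Suc t) LY = (\<Sum>w\<in>words_of_type s t. Poly_Mapping.lookup p (w @ [LY]))"
  unfolding phi_end_def words_of_type_last
  by (subst sum.reindex; simp add: inj_on_def words_of_type_def)+

lemma phi_split_end:
  assumes "s + t > 0"
  shows "phi p s t = phi_end p s t LX + phi_end p s t LY"
proof -
  have "[] \<notin> words_of_type s t" using assms by (auto simp: words_of_type_def)
  then have eq: "words_of_type s t = {w \<in> words_of_type s t. w \<noteq> [] \<and> last w = LX} \<union> {w \<in> words_of_type s t. w \<noteq> [] \<and> last w = LY}"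
    by (auto intro: letter.exhaust)
  show ?thesis
    unfolding phi_def phi_end_def by (subst eq, rule sum.union_disjoint) auto
qed

text \<open>Lists 1 and 2 exclude a function of the sum by asymmetry, list 3 by the missing pure
  power.\<close>

lemma (in two_reps) classQ_matches:
  assumes "p \<in> classQ" and c: "c = Poly_Mapping.lookup p"
  obtains s t where "\<forall>i<k. \<exists>j. matches i j" "type_sum c s t \<noteq> 0" "s \<ge> 2" "t \<ge> 2"
    "\<exists>g h. g LX + g LY = h LX + h LY \<and> comm_part (s + t) c g \<noteq> comm_part (s + t) c h"
proof -
  consider "list1 p" | "list2 p" | "list3 p" using assms(1) by (auto simp: classQ_def)
  then show thesis
  proof cases
    case 1
    then obtain s t where st: "s \<ge> t + 2" "t + 2 \<ge> 4" "type_sum c s t \<noteq> 0" "type_sum c s t \<noteq> type_sum c t s"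
      unfolding list1_def phi_eq_type_sum c by blast
    show thesis
    proof (rule that[of s t])
      show "\<forall>i<k. \<exists>j. matches i j" using list1_matches[OF _ st(3)] st by simp
    show "\<exists>g h. g LX + g LY = h LX + h LY \<and> comm_part (s + t) c g \<noteq> comm_part (s + t) c h"
        by (rule comm_part_not_sum_asym[OF st(4)])
    qed (use st in auto)
  next
    case 2
    then obtain t where t: "t \<ge> 2" "type_sum c (Suc t) t \<noteq> 0" "type_sum c (Suc t) t \<noteq> type_sum c t (Suc t)"
      "type_sum c (Suc t) t \<noteq> c (alt LX LY (Suc (2 * t)))" "type_sum c (Suc t) t \<noteq> c (alt LY LX (Suc (2 * t)))"
      unfolding list2_def phi_eq_type_sum c alt_odd by auto
    show thesis
    proof (rule that[of "Suc t" t])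
      show "\<forall>i<k. \<exists>j. matches i j" using list2_matches[OF _ t] by simp
    show "\<exists>g h. g LX + g LY = h LX + h LY \<and> comm_part (Suc t + t) c g \<noteq> comm_part (Suc t + t) c h"
        by (rule comm_part_not_sum_asym[OF t(3)])
    qed (use t in auto)
  next
    case 3
    then obtain r where r: "r \<ge> 2" "type_sum c r r \<noteq> 0" "type_sum c (2 * r) 0 = 0"
      and ends: "phi_end p r r LX \<noteq> 0 \<longleftrightarrow> phi_end p r r LY \<noteq> 0"
      unfolding list3_def phi_eq_type_sum c by (metis mult_2 not_numeral_le_zero neq0_conv)
    \<comment> \<open>The two ending sums add up to a nonzero number and vanish together, so neither
      vanishes.\<close>
    have "phi_end p r r LX + phi_end p r r LY \<noteq> 0"
      using phi_split_end[of r r p] r by (simp add: phi_eq_type_sum c)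
    with ends have e: "phi_end p r r LX \<noteq> 0" "phi_end p r r LY \<noteq> 0" by auto
    obtain r' where r': "r = Suc r'" using r(1) by (cases r) auto
    have e': "(\<Sum>w\<in>words_of_type (r - 1) r. c (w @ [LX])) \<noteq> 0" "(\<Sum>w\<in>words_of_type r (r - 1). c (w @ [LY])) \<noteq> 0"
      using e phi_end_LX[of p r' r] phi_end_LY[of p r r'] by (simp_all add: r' c)
    show thesis
    proof (rule that[of r r])
      show "\<forall>i<k. \<exists>j. matches i j" using list3_matches[OF _ r(1,2) e'] by simp
      show "\<exists>g h. g LX + g LY = h LX + h LY \<and> comm_part (r + r) c g \<noteq> comm_part (r + r) c h"
        by (rule comm_part_not_sum_pure) (use r in \<open>auto simp: mult_2[symmetric]\<close>)
    qed (use r in auto)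
  qed
qed

section \<open>Renaming of vertices and permutation matrices\<close>

lemma weval_permute:
  assumes "bij_betw \<sigma> {..<k} {..<k}" "i < k" "j < k"
  shows "weval k (\<lambda>a i j. A a (\<sigma> i) (\<sigma> j)) w i j = weval k A w (\<sigma> i) (\<sigma> j)"
  using assms(2)
proof (induction w arbitrary: i)
  case Nil
  have "\<sigma> i = \<sigma> j \<longleftrightarrow> i = j"
    using assms(1,3) Nil by (auto simp: bij_betw_def inj_on_def)
  then show ?case by (simp add: weval_Nil)
next
  case (Cons a w)
  have "weval k (\<lambda>a i j. A a (\<sigma> i) (\<sigma> j)) (a # w) i j
      = (\<Sum>l<k. A a (\<sigma> i) (\<sigma> l) * weval k A w (\<sigma> l) (\<sigma> j))"
    unfolding weval_Cons using Cons.IH by (intro sum.cong) auto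
  also have "\<dots> = weval k A (a # w) (\<sigma> i) (\<sigma> j)"
    unfolding weval_Cons
    by (rule sum.reindex_bij_betw[OF assms(1), of "\<lambda>l. A a (\<sigma> i) l * weval k A w l (\<sigma> j)"])
  finally show ?case .
qed

lemma (in two_reps) classQ_rigidity:
  assumes "p \<in> classQ" "c = Poly_Mapping.lookup p" "k \<ge> 1"
  shows "\<exists>\<sigma> \<omega>. bij_betw \<sigma> {..<k} {..<k} \<and> (\<omega> = id \<or> \<omega> = swap_letter) \<and>
    ((\<forall>a. \<forall>i<k. \<forall>j<k. E a i j = E' (\<omega> a) (\<sigma> i) (\<sigma> j)) \<or>
     (\<forall>a. \<forall>i<k. \<forall>j<k. E a i j = E' (\<omega> a) (\<sigma> j) (\<sigma> i)))"
proof -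
  obtain s t where m: "\<forall>i<k. \<exists>j. matches i j"
    and st: "type_sum c s t \<noteq> 0" "s \<ge> 2" "t \<ge> 2"
    and ns: "\<exists>g h. g LX + g LY = h LX + h LY \<and> comm_part (s + t) c g \<noteq> comm_part (s + t) c h"
    using classQ_matches[OF assms(1,2)] .
  obtain \<sigma> where \<sigma>: "\<And>i. i < k \<Longrightarrow> matches i (\<sigma> i)" using m by metis
  have inj: "inj_on \<sigma> {..<k}"
  proof (rule inj_onI)
    fix i i' assume *: "i \<in> {..<k}" "i' \<in> {..<k}" "\<sigma> i = \<sigma> i'"
    then have "\<pi> (i, i) = \<pi> (i', i')" using \<sigma>[of i] \<sigma>[of i'] by (simp add: matches_def)
    then show "i = i'" using pi_inj * by blast
  qed
  have "\<sigma> ` {..<k} \<subseteq> {..<k}" using \<sigma> by (auto simp: matches_def)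
  then have bij\<sigma>: "bij_betw \<sigma> {..<k} {..<k}"
    using inj by (simp add: bij_betw_def endo_inj_surj)
  define \<tau> where "\<tau> = the_inv_into {..<k} \<sigma>"
  have bij\<tau>: "bij_betw \<tau> {..<k} {..<k}" unfolding \<tau>_def by (rule bij_betw_the_inv_into[OF bij\<sigma>])
  have \<tau>\<sigma>: "\<tau> (\<sigma> i) = i" if "i < k" for i
    unfolding \<tau>_def using the_inv_into_f_f[OF inj] that by simp
  have \<sigma>\<tau>: "\<sigma> (\<tau> i) = i" if "i < k" for i
    unfolding \<tau>_def using f_the_inv_into_f_bij_betw[OF bij\<sigma>] that by simp
  have \<tau>_less: "\<tau> i < k" if "i < k" for i using bij_betwE[OF bij\<tau>] that by simp
  \<comment> \<open>Renaming the vertices of the second grid by \<open>\<sigma>\<close> puts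
    matching loops at the same vertex; \<open>\<pi>\<close> is corrected by the inverse
    \<open>\<tau>\<close> in both coordinates.\<close>
  let ?E = "\<lambda>a i j. E' a (\<sigma> i) (\<sigma> j)" and ?\<pi> = "map_prod \<tau> \<tau> \<circ> \<pi>"
  interpret G: grid k V ?E
  proof
    have "bij_betw (map_prod id (map_prod \<sigma> \<sigma>)) ((UNIV :: letter set) \<times> {..<k} \<times> {..<k}) (UNIV \<times> {..<k} \<times> {..<k})"
      by (intro bij_betw_map_prod bij\<sigma> bij_betw_id)
    from bij_betw_trans[OF this B.bij]
    show "bij_betw (\<lambda>(a, i, j). ?E a i j) (UNIV \<times> {..<k} \<times> {..<k}) V"
      by (simp add: comp_def case_prod_unfold map_prod_def)
  qed
  have G_ev: "G.ev n d z i j = B.ev n d z (\<sigma> i) (\<sigma> j)" if "i < k" "j < k" for n d z i j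
    unfolding G.ev_def B.ev_def
    by (intro sum.cong refl arg_cong2[where f = "(*)"] weval_permute[OF bij\<sigma> that, of "\<lambda>a i j. z (E' a i j)"])
  interpret M: matched k V E ?E "s + t" c c' ?\<pi>
  proof unfold_locales
    show "bij_betw ?\<pi> ({..<k} \<times> {..<k}) ({..<k} \<times> {..<k})"
      by (rule bij_betw_trans[OF pi_bij bij_betw_map_prod[OF bij\<tau> bij\<tau>]])
    show "A.ev (s + t) c z i j = G.ev (s + t) c' z (fst (?\<pi> (i, j))) (snd (?\<pi> (i, j)))"
      if "i < k" "j < k" for i j z
      using ev_eq[OF that] pi_less[OF that] by (simp add: G_ev \<tau>_less \<sigma>\<tau>)
    show "?\<pi> (i, i) = (i, i)" "range (\<lambda>a. E a i i) = range (\<lambda>a. ?E a i i)" if "i < k" for i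
      using \<sigma>[OF that] \<tau>\<sigma>[OF that] by (simp_all add: matches_def)
    show "\<not> (\<exists>\<alpha> \<beta>. \<forall>g. comm_part (s + t) c g = \<alpha> + (\<Sum>a\<in>UNIV. \<beta> a * g a))"
      by (rule comm_part_not_affine[OF st(1,2)])
    show "\<exists>g h. (\<forall>b. b \<noteq> a \<longrightarrow> g b = h b) \<and> comm_part (s + t) c g \<noteq> comm_part (s + t) c h" for a
      by (rule comm_part_depends) (use st in auto)
    show "\<exists>g h. g LX + g LY = h LX + h LY \<and> comm_part (s + t) c g \<noteq> comm_part (s + t) c h"
      by (rule ns)
  qed
  show ?thesis using M.rigidity[OF assms(3)] bij\<sigma> by blast
qed

text \<open>The inverse comes from the convention of \<open>perm_matrix\<close>, which describes
  rows: with the 1 of row \<open>l\<close> in column \<open>inv \<sigma> l\<close>, column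
  \<open>i\<close> has its 1 in row \<open>\<sigma> i\<close>.\<close>

lemma conj_perm_permutation:
  assumes "\<sigma> permutes {0..<k}" "i < k" "j < k"
  shows "conj_perm k (\<lambda>l m. if inv \<sigma> l = m then 1 else 0) A i j = A (\<sigma> i) (\<sigma> j)"
proof -
  have inv: "inv \<sigma> l = m \<longleftrightarrow> l = \<sigma> m" for l m
    using permutes_inverses[OF assms(1)] by metis
  have less: "\<sigma> i < k" "\<sigma> j < k" using permutes_in_image[OF assms(1)] assms(2,3) by auto
  have c: "cconst 1 = 1" "cconst 0 = 0" by (simp_all add: cconst_def)
  show ?thesis
    using less by (simp add: conj_perm_def mat_mul_def mat_transpose_def mat_map_def inv c
        if_distrib[of cconst] if_distrib[of "\<lambda>u. u * _"] if_distrib[of "\<lambda>u. _ * u"] sum.delta cong: if_cong)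
qed

lemma grid_of_var_matrices:
  assumes "var_matrices k X Y"
  shows "grid k {1..2 * k ^ 2} (case_letter X Y)"
proof
  have "bij_betw (map_prod (\<lambda>a. a = LX) id) ((UNIV :: letter set) \<times> {0..<k} \<times> {0..<k}) (UNIV \<times> {0..<k} \<times> {0..<k})"
  proof (intro bij_betw_map_prod bij_betw_id)
    show "bij_betw (\<lambda>a. a = LX) UNIV UNIV"
      by (rule bij_betw_byWitness[where f' = "\<lambda>b. if b then LX else LY"]) (auto intro: letter.exhaust)
  qed
  from bij_betw_trans[OF this assms[unfolded var_matrices_def]]
  have "bij_betw ((\<lambda>(b, i, j). if b then X i j else Y i j) \<circ> map_prod (\<lambda>a. a = LX) id)
    (UNIV \<times> {..<k} \<times> {..<k}) {1..2 * k ^ 2}" by (simp add: lessThan_atLeast0)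
  moreover have "(\<lambda>(b, i, j). if b then X i j else Y i j) \<circ> map_prod (\<lambda>a. a = LX) id
    = (\<lambda>(a, i, j). case_letter X Y a i j)"
    by (auto simp: fun_eq_iff split: letter.splits)
  ultimately show "bij_betw (\<lambda>(a, i, j). case_letter X Y a i j) (UNIV \<times> {..<k} \<times> {..<k}) {1..2 * k ^ 2}"
    by simp
qed

theorem theorem7p15:
  fixes k :: nat and P :: "nat \<Rightarrow> cpoly"
    and p q :: ncpoly and X Y X' Y' :: "nat sqmat"
  assumes "k \<ge> 1"
    and "nc_representation k P p X Y" and "p \<in> classQ"
    and "nc_representation k P q X' Y'" and "q \<in> classQ"
  shows "\<exists>PM. perm_matrix k PM \<and>
    ((mat_eq k (var_mat X) (conj_perm k PM (var_mat X')) \<and>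
      mat_eq k (var_mat Y) (conj_perm k PM (var_mat Y')))
   \<or> (mat_eq k (var_mat X) (conj_perm k PM (mat_transpose (var_mat X'))) \<and>
      mat_eq k (var_mat Y) (conj_perm k PM (mat_transpose (var_mat Y'))))
   \<or> (mat_eq k (var_mat X) (conj_perm k PM (var_mat Y')) \<and>
      mat_eq k (var_mat Y) (conj_perm k PM (var_mat X')))
   \<or> (mat_eq k (var_mat X) (conj_perm k PM (mat_transpose (var_mat Y'))) \<and>
      mat_eq k (var_mat Y) (conj_perm k PM (mat_transpose (var_mat X')))))"
proof -
  let ?V = "{1..2 * k ^ 2}" and ?E = "case_letter X Y" and ?E' = "case_letter X' Y'" and ?S = "{..<k} \<times> {..<k}"
  obtain \<tau> where \<tau>: "bij_betw \<tau> ?S {1..k ^ 2}"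
    and p: "\<And>i j. i < k \<Longrightarrow> j < k \<Longrightarrow> nc_eval k p (var_mat X) (var_mat Y) i j = P (\<tau> (i, j))"
    using assms(2) unfolding nc_representation_def lessThan_atLeast0 by blast
  obtain \<tau>' where \<tau>': "bij_betw \<tau>' ?S {1..k ^ 2}"
    and q: "\<And>i j. i < k \<Longrightarrow> j < k \<Longrightarrow> nc_eval k q (var_mat X') (var_mat Y') i j = P (\<tau>' (i, j))"
    using assms(4) unfolding nc_representation_def lessThan_atLeast0 by blast
  \<comment> \<open>Entries are matched through their numbers in the family, which gives a bijection
    even if members of the family coincide.\<close>
  define \<pi> where "\<pi> = the_inv_into ?S \<tau>' \<circ> \<tau>"
  have pi_bij: "bij_betw \<pi> ?S ?S"
    unfolding \<pi>_def by (rule bij_betw_trans[OF \<tau> bij_betw_the_inv_into[OF \<tau>']])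
  interpret A: grid k ?V ?E
    by (rule grid_of_var_matrices) (use assms(2) in \<open>simp add: nc_representation_def\<close>)
  interpret B: grid k ?V ?E'
    by (rule grid_of_var_matrices) (use assms(4) in \<open>simp add: nc_representation_def\<close>)
  interpret two_reps k ?V ?E ?E' "Poly_Mapping.lookup p" "Poly_Mapping.lookup q" \<pi>
  proof
    show "bij_betw \<pi> ?S ?S" by (rule pi_bij)
    fix i j M assume ij: "i < k" "j < k" and M: "set_mset M \<subseteq> ?V"
    obtain ys where ys: "mset ys = M" using ex_mset by blast
    have "set ys \<subseteq> ?V" using M ys by auto
    obtain i' j' where i'j': "\<pi> (i, j) = (i', j')" "i' < k" "j' < k"
      using bij_betwE[OF pi_bij] ij by (metis SigmaE lessThan_iff mem_Sigma_iff)
    have "\<tau> (i, j) \<in> {1..k ^ 2}" using bij_betwE[OF \<tau>] ij by simp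
    then have "\<tau>' (\<pi> (i, j)) = \<tau> (i, j)"
      unfolding \<pi>_def using f_the_inv_into_f_bij_betw[OF \<tau>'] by simp
    then have "nc_eval k p (var_mat X) (var_mat Y) i j = nc_eval k q (var_mat X') (var_mat Y') i' j'"
      using p ij q i'j' by simp
    then show "A.coef (Poly_Mapping.lookup p) M i j
        = B.coef (Poly_Mapping.lookup q) M (fst (\<pi> (i, j))) (snd (\<pi> (i, j)))"
      using A.lookup_nc_eval[OF ij \<open>set ys \<subseteq> ?V\<close>, of p] B.lookup_nc_eval[OF i'j'(2,3) \<open>set ys \<subseteq> ?V\<close>, of q]
      by (simp add: ys i'j'(1))
  qed
  obtain \<sigma> \<omega> where \<sigma>: "bij_betw \<sigma> {..<k} {..<k}" and \<omega>: "\<omega> = id \<or> \<omega> = swap_letter"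
    and E: "(\<forall>a. \<forall>i<k. \<forall>j<k. ?E a i j = ?E' (\<omega> a) (\<sigma> i) (\<sigma> j)) \<or>
            (\<forall>a. \<forall>i<k. \<forall>j<k. ?E a i j = ?E' (\<omega> a) (\<sigma> j) (\<sigma> i))"
    using classQ_rigidity[OF assms(3) refl assms(1)] by blast
  \<comment> \<open>\<open>permutes\<close> demands the identity outside the index range.\<close>
  define \<rho> where "\<rho> = (\<lambda>i. if i < k then \<sigma> i else i)"
  have \<rho>: "\<rho> permutes {0..<k}"
  proof (rule bij_imp_permutes)
    show "bij_betw \<rho> {0..<k} {0..<k}"
      using \<sigma> by (subst bij_betw_cong[of _ _ \<sigma>]) (auto simp: \<rho>_def lessThan_atLeast0)
  qed (simp add: \<rho>_def)
  define PM :: "real sqmat" where "PM = (\<lambda>l m. if inv \<rho> l = m then 1 else 0)"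
  have PM: "perm_matrix k PM"
    unfolding perm_matrix_def PM_def using permutes_inv[OF \<rho>] by blast
  have eqI: "mat_eq k (var_mat Z) (conj_perm k PM W)"
    if "\<And>i j. i < k \<Longrightarrow> j < k \<Longrightarrow> cvar (Z i j) = W (\<sigma> i) (\<sigma> j)" for Z W
    unfolding mat_eq_def PM_def using conj_perm_permutation[OF \<rho>] that
    by (simp add: var_mat_def mat_map_def \<rho>_def)
  from \<omega> E consider
      "\<forall>a. \<forall>i<k. \<forall>j<k. ?E a i j = ?E' a (\<sigma> i) (\<sigma> j)"
    | "\<forall>a. \<forall>i<k. \<forall>j<k. ?E a i j = ?E' a (\<sigma> j) (\<sigma> i)"
    | "\<forall>a. \<forall>i<k. \<forall>j<k. ?E a i j = ?E' (swap_letter a) (\<sigma> i) (\<sigma> j)"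
    | "\<forall>a. \<forall>i<k. \<forall>j<k. ?E a i j = ?E' (swap_letter a) (\<sigma> j) (\<sigma> i)"
    unfolding id_apply by fastforce
  then show ?thesis
  proof cases
    case 1
    then have XY: "X i j = X' (\<sigma> i) (\<sigma> j)" "Y i j = Y' (\<sigma> i) (\<sigma> j)" if "i < k" "j < k" for i j
      using that by (metis letter.case)+
    have "mat_eq k (var_mat X) (conj_perm k PM (var_mat X'))"
      "mat_eq k (var_mat Y) (conj_perm k PM (var_mat Y'))"
      by (rule eqI, simp add: XY var_mat_def mat_map_def)+
    with PM show ?thesis by blast
  next
    case 2
    then have XY: "X i j = X' (\<sigma> j) (\<sigma> i)" "Y i j = Y' (\<sigma> j) (\<sigma> i)" if "i < k" "j < k" for i j
      using that by (metis letter.case)+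
    have "mat_eq k (var_mat X) (conj_perm k PM (mat_transpose (var_mat X')))"
      "mat_eq k (var_mat Y) (conj_perm k PM (mat_transpose (var_mat Y')))"
      by (rule eqI, simp add: XY var_mat_def mat_map_def mat_transpose_def)+
    with PM show ?thesis by blast
  next
    case 3
    then have XY: "X i j = Y' (\<sigma> i) (\<sigma> j)" "Y i j = X' (\<sigma> i) (\<sigma> j)" if "i < k" "j < k" for i j
      using that by (metis letter.case swap_letter_simps(1,2))+
    have "mat_eq k (var_mat X) (conj_perm k PM (var_mat Y'))"
      "mat_eq k (var_mat Y) (conj_perm k PM (var_mat X'))"
      by (rule eqI, simp add: XY var_mat_def mat_map_def)+
    with PM show ?thesis by blast
  next
    case 4
    then have XY: "X i j = Y' (\<sigma> j) (\<sigma> i)" "Y i j = X' (\<sigma> j) (\<sigma> i)" if "i < k" "j < k" for i j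
      using that by (metis letter.case swap_letter_simps(1,2))+
    have "mat_eq k (var_mat X) (conj_perm k PM (mat_transpose (var_mat Y')))"
      "mat_eq k (var_mat Y) (conj_perm k PM (mat_transpose (var_mat X')))"
      by (rule eqI, simp add: XY var_mat_def mat_map_def mat_transpose_def)+
    with PM show ?thesis by blast
  qed
qed

end
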